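(* Let $\beta\in(0,1)$ and $\gamma\in(0,1)$. Let $(X_k)_{k\in\mathbb{N}}$ be i.i.d. nonnegative random variables in $\mathcal{RV}_{-\beta}$ with tail $\bar F(x)=\mathbb{P}[X_1>x]$, and let $(\mathrm{N}(t))_{t\ge0}$ be a stochastic process with nonnegative integer values, independent of $(X_k)_{k\in\mathbb{N}}$, with generating function $\phi_{\mathrm{N}(t)}(z)=\sum_{n\ge0}\mathbb{P}[\mathrm{N}(t)=n]z^n$, $z\in[0,1]$. Assume that there exist two positive families $(C_t)_{t\ge0}$ and $(z_t)_{t\ge0}$, with $z_t<1$ and $z_t\to1$ as $t\to\infty$, such that $$\phi_{\mathrm{N}(t)}(z)=1-C_t(1-z)^{\gamma}+\mathcal{E}_t(1-z),$$ where, for each fixed $t$, $\mathcal{E}_t(u)=o(u^{\gamma})$ as $u\to0^+$, and for every $\lambda>0$ $$\lim_{t\to\infty}\ \sup_{0<1-z\le\lambda(1-z_t)}\frac{|\mathcal{E}_t(1-z)|}{C_t(1-z)^{\gamma}}=0 .$$ Let $S_0:=0$ and $S_{\mathrm{N}(t)}:=\sum_{k=1}^{\mathrm{N}(t)}X_k$ for $\mathrm{N}(t)\ge1$. Then, for every $(x_t)_{t\ge 0}$ with $x_t\to\infty$ as $t\to\infty$ such that $\mathbb{P}[X_1>x_t]\le K(1-z_t)$ for some $K>0$, $$\lim_{t\to\infty}\ \sup_{x\ge x_t}\left|\frac{\mathbb{P}[S_{\mathrm{N}(t)}>x]}{C(\gamma,\beta)\,\mathbb{P}[\bar F(x)\,\mathrm{N}(t)>1]}-1\right|=0,\qquad\text{where}\quad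 C(\gamma,\beta):=\frac{\Gamma(1-\gamma)\,[\Gamma(1-\beta)]^{\gamma}}{\Gamma(1-\gamma\beta)} .$$
   Context: A random variable $X$ belongs to $\mathcal{RV}_{-\beta}$ if $\mathbb{P}[X>x]=x^{-\beta}\ell(x)$ with $\ell$ slowly varying at infinity, i.e. $\lim_{x\to\infty}\ell(\Lambda x)/\ell(x)=1$ for every $\Lambda>0$. The setting is that of random times with infinite mean, $\mathbb{E}[\mathrm{N}(t)]=\infty$ (which is implied by the expansion with $\gamma\in(0,1)$ and $C_t>0$). *)

theory Defs
  imports "HOL-Probability.Probability" "HOL-Library.Landau_Symbols"
begin

definition slowly_varying :: "(real \<Rightarrow> real) \<Rightarrow> bool" where
  "slowly_varying l \<longleftrightarrow> (\<forall>\<Lambda>>0. ((\<lambda>x. l (\<Lambda> * x) / l x) \<longlongrightarrow> 1) at_top)"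

definition tail_prob :: "'a measure \<Rightarrow> ('a \<Rightarrow> real) \<Rightarrow> real \<Rightarrow> real" where
  "tail_prob M X x = \<P>(\<omega> in M. X \<omega> > x)"

(* The random variable X belongs to RV_{-beta}; the factorisation of the tail is only
   meaningful for x > 0, which determines l near infinity. *)
definition reg_var_tail :: "'a measure \<Rightarrow> real \<Rightarrow> ('a \<Rightarrow> real) \<Rightarrow> bool" where
  "reg_var_tail M \<beta> X \<longleftrightarrow>
     (\<exists>l. slowly_varying l \<and> (\<forall>x>0. tail_prob M X x = x powr (-\<beta>) * l x))"

definition prob_gen_fun :: "'a measure \<Rightarrow> ('a \<Rightarrow> nat) \<Rightarrow> real \<Rightarrow> real" where
  "prob_gen_fun M N z = (\<Sum>n. \<P>(\<omega> in M. N \<omega> = n) * z ^ n)"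

definition family_sigma ::
  "'a measure \<Rightarrow> 'b measure \<Rightarrow> ('i \<Rightarrow> 'a \<Rightarrow> 'b) \<Rightarrow> 'i set \<Rightarrow> 'a set set" where
  "family_sigma M S Y I =
     sigma_sets (space M) (\<Union>i\<in>I. {Y i -` A \<inter> space M | A. A \<in> sets S})"

(* Independence is stated through the generated sigma-algebras because indep_var requires
   both random elements to have values in the same type. *)
definition indep_families ::
  "'a measure \<Rightarrow> 'b measure \<Rightarrow> ('i \<Rightarrow> 'a \<Rightarrow> 'b) \<Rightarrow> 'i set \<Rightarrow>
   'c measure \<Rightarrow> ('j \<Rightarrow> 'a \<Rightarrow> 'c) \<Rightarrow> 'j set \<Rightarrow> bool" where
  "indep_families M S Y I T Z J \<longleftrightarrow>
     prob_space.indep_set M (family_sigma M S Y I) (family_sigma M T Z J)"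

definition random_sum :: "(nat \<Rightarrow> 'a \<Rightarrow> real) \<Rightarrow> ('a \<Rightarrow> nat) \<Rightarrow> 'a \<Rightarrow> real" where
  "random_sum X N \<omega> = (\<Sum>k=1..N \<omega>. X k \<omega>)"

definition C_const :: "real \<Rightarrow> real \<Rightarrow> real" where
  "C_const \<gamma> \<beta> = Gamma (1 - \<gamma>) * Gamma (1 - \<beta>) powr \<gamma> / Gamma (1 - \<gamma> * \<beta>)"

end

theory Submission
  imports Defs
begin

text \<open>
  Put \<open>a = C t * F x powr \<gamma>\<close> with \<open>F = tail_prob M (X 1)\<close>. The expansion of the generating function
  gives \<open>1 - E (exp (- s * F x * N t)) \<sim> a * s powr \<gamma>\<close>. Since
  \<open>1 - E (exp (- s * X 1 / x)) \<sim> \<Gamma>(1 - \<beta>) * s powr \<beta> * F x\<close> by Potter's bound and dominated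
  convergence, it also gives
  \<open>1 - E (exp (- s * S / x)) \<sim> a * \<Gamma>(1 - \<beta>) powr \<gamma> * s powr (\<gamma> * \<beta>)\<close> for the random sum \<open>S\<close>.
  Karamata's Tauberian theorem turns both relations into tail asymptotics, whose quotient is the
  constant. All limits are taken along a filter on pairs \<open>(t, x)\<close> with \<open>t \<rightarrow> \<infinity>\<close> and \<open>x \<ge> xt t\<close>;
  convergence along it is exactly uniformity in \<open>x\<close>, and the Tauberian theorem holds along any filter.
\<close>

section \<open>A Tauberian theorem by polynomial approximation\<close>

text \<open>The law of \<open>Y i\<close> divided by \<open>a i\<close> has mass
  \<open>1 / a i\<close>, which may be unbounded, and its limit has infinite mass near 0, so weak
  convergence of probability measures does not apply. Weighting by \<open>1 - exp (- y)\<close>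
  makes the limit finite. In the variable u = exp(-y) the hypothesis then gives convergence of all
  polynomial integrals on [0,1], which is the setting of Karamata's approximation argument, with
  \<open>a i\<close> an arbitrary positive normalisation. The limit measure with tail K y^(-\<rho>)
  has the Laplace functional K Gamma(1-\<rho>) s^\<rho>. Taking \<rho> = \<gamma> yields 1 /
  Gamma(1-\<gamma>) for the random times; taking \<rho> = \<gamma>\<beta> yields
  Gamma(1-\<beta>)^\<gamma> / Gamma(1-\<gamma>\<beta>) for the sum. The remainder of the expansion
  is controlled uniformly only for arguments of order 1 - z_t. Both transforms use arguments of
  order F(x), and F(x) \<le> F(x_t) \<le> K (1 - z_t) keeps them in that window for all x \<ge> x_t
  at once.\<close>

text \<open>With w = exp(-Y) one has (1 - w) w^i = (1 - w^(i+1)) - (1 - w^i), so a polynomial in w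
  against the weight 1 - w involves Laplace values at integer frequencies only. The differences keep
  the form 1 - exp because the exponentials alone need not be integrable under an infinite
  measure.\<close>

lemma integral_laplace_polynomial:
  fixes c :: "nat \<Rightarrow> real"
  assumes int: "\<And>k::nat. integrable M (\<lambda>\<omega>. 1 - exp (- real k * Y \<omega>))"
  shows "integrable M (\<lambda>\<omega>. (1 - exp (- Y \<omega>)) * (\<Sum>i\<le>n. c i * exp (- Y \<omega>) ^ i))"
    and "(\<integral>\<omega>. (1 - exp (- Y \<omega>)) * (\<Sum>i\<le>n. c i * exp (- Y \<omega>) ^ i) \<partial>M) =
      (\<Sum>i\<le>n. c i * ((\<integral>\<omega>. 1 - exp (- real (Suc i) * Y \<omega>) \<partial>M) - (\<integral>\<omega>. 1 - exp (- real i * Y \<omega>) \<partial>M)))"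
proof -
  have eq: "(1 - exp (- Y \<omega>)) * (\<Sum>i\<le>n. c i * exp (- Y \<omega>) ^ i) =
    (\<Sum>i\<le>n. c i * ((1 - exp (- real (Suc i) * Y \<omega>)) - (1 - exp (- real i * Y \<omega>))))" for \<omega>
    unfolding sum_distrib_left
    by (intro sum.cong refl) (simp add: exp_of_nat_mult[symmetric] exp_add[symmetric] algebra_simps)
  show "integrable M (\<lambda>\<omega>. (1 - exp (- Y \<omega>)) * (\<Sum>i\<le>n. c i * exp (- Y \<omega>) ^ i))"
    unfolding eq by (intro Bochner_Integration.integrable_sum integrable_mult_right Bochner_Integration.integrable_diff int)
  show "(\<integral>\<omega>. (1 - exp (- Y \<omega>)) * (\<Sum>i\<le>n. c i * exp (- Y \<omega>) ^ i) \<partial>M) =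
      (\<Sum>i\<le>n. c i * ((\<integral>\<omega>. 1 - exp (- real (Suc i) * Y \<omega>) \<partial>M) - (\<integral>\<omega>. 1 - exp (- real i * Y \<omega>) \<partial>M)))"
    unfolding eq
    by (simp only: Bochner_Integration.integral_sum integrable_mult_right Bochner_Integration.integrable_diff int
        integral_mult_right_zero Bochner_Integration.integral_diff[OF int int])
qed

text \<open>The weight 1 - exp(-Y) is nonnegative and integrable, and exp(-Y) lies in [0,1]. A
  uniform error \<open>e\<close> there costs at most \<open>e\<close> times the integral of the
  weight, also under an infinite measure.\<close>

lemma integral_laplace_approx:
  fixes f g :: "real \<Rightarrow> real"
  assumes int: "integrable M (\<lambda>\<omega>. 1 - exp (- Y \<omega>))"
    and [measurable]: "Y \<in> borel_measurable M" "f \<in> borel_measurable borel"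
    and g: "integrable M (\<lambda>\<omega>. (1 - exp (- Y \<omega>)) * g (exp (- Y \<omega>)))"
    and nonneg: "AE \<omega> in M. 0 \<le> Y \<omega>"
    and approx: "\<And>u. u \<in> {0..1} \<Longrightarrow> \<bar>f u - g u\<bar> \<le> e"
  shows "integrable M (\<lambda>\<omega>. (1 - exp (- Y \<omega>)) * f (exp (- Y \<omega>)))"
    and "\<bar>(\<integral>\<omega>. (1 - exp (- Y \<omega>)) * f (exp (- Y \<omega>)) \<partial>M) - (\<integral>\<omega>. (1 - exp (- Y \<omega>)) * g (exp (- Y \<omega>)) \<partial>M)\<bar>
      \<le> e * (\<integral>\<omega>. 1 - exp (- Y \<omega>) \<partial>M)"
proof -
  let ?f = "\<lambda>\<omega>. (1 - exp (- Y \<omega>)) * f (exp (- Y \<omega>))"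
  let ?g = "\<lambda>\<omega>. (1 - exp (- Y \<omega>)) * g (exp (- Y \<omega>))"
  have [measurable]: "?g \<in> borel_measurable M" using g by auto
  have bd: "AE \<omega> in M. \<bar>?f \<omega> - ?g \<omega>\<bar> \<le> e * (1 - exp (- Y \<omega>))"
    using nonneg
  proof eventually_elim
    case (elim \<omega>)
    have "\<bar>?f \<omega> - ?g \<omega>\<bar> = (1 - exp (- Y \<omega>)) * \<bar>f (exp (- Y \<omega>)) - g (exp (- Y \<omega>))\<bar>"
      using elim by (simp add: abs_mult right_diff_distrib[symmetric])
    also have "\<dots> \<le> (1 - exp (- Y \<omega>)) * e"
      using elim by (intro mult_left_mono approx) auto
    finally show ?case by (simp add: mult.commute)
  qed
  have d: "integrable M (\<lambda>\<omega>. ?f \<omega> - ?g \<omega>)"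
  proof (rule Bochner_Integration.integrable_bound)
    show "integrable M (\<lambda>\<omega>. e * (1 - exp (- Y \<omega>)))" using int by simp
    show "AE \<omega> in M. norm (?f \<omega> - ?g \<omega>) \<le> norm (e * (1 - exp (- Y \<omega>)))"
      using bd by eventually_elim simp
  qed measurable
  from Bochner_Integration.integrable_add[OF d g] show f: "integrable M ?f" by simp
  have "\<bar>(\<integral>\<omega>. ?f \<omega> \<partial>M) - (\<integral>\<omega>. ?g \<omega> \<partial>M)\<bar> = \<bar>\<integral>\<omega>. ?f \<omega> - ?g \<omega> \<partial>M\<bar>"
    by (simp add: Bochner_Integration.integral_diff[OF f g])
  also have "\<dots> \<le> (\<integral>\<omega>. \<bar>?f \<omega> - ?g \<omega>\<bar> \<partial>M)" by (rule integral_abs_bound)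
  also have "\<dots> \<le> (\<integral>\<omega>. e * (1 - exp (- Y \<omega>)) \<partial>M)"
    using int d bd by (intro integral_mono_AE) auto
  finally show "\<bar>(\<integral>\<omega>. ?f \<omega> \<partial>M) - (\<integral>\<omega>. ?g \<omega> \<partial>M)\<bar> \<le> e * (\<integral>\<omega>. 1 - exp (- Y \<omega>) \<partial>M)"
    by simp
qed

lemma weierstrass_unit_interval:
  fixes f :: "real \<Rightarrow> real"
  assumes "continuous_on UNIV f" "e > 0"
  obtains c and n :: nat where "\<And>u. u \<in> {0..1} \<Longrightarrow> \<bar>f u - (\<Sum>i\<le>n. c i * u ^ i)\<bar> \<le> e"
proof -
  obtain g where g: "real_polynomial_function g" "\<And>u. u \<in> {0..1} \<Longrightarrow> \<bar>f u - g u\<bar> < e"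
    using Stone_Weierstrass_real_polynomial_function[of "{0..1::real}" f e] assms
      continuous_on_subset[of UNIV f] by auto
  from real_polynomial_function_imp_sum[OF g(1)] obtain c n where "g = (\<lambda>x. \<Sum>i\<le>n::nat. c i * x ^ i)"
    by auto
  with g(2) that[where c = c and n = n] show ?thesis by (simp add: less_imp_le)
qed

text \<open>The weighted masses converge to the finite number \<open>B\<close>, which is the case k
  = 1, and polynomials in exp(-y) converge by hypothesis. Weierstrass approximation extends this to
  continuous \<open>f\<close>, because the weighted masses eventually stay below B + 1.\<close>

lemma laplace_functional_tendsto:
  fixes Y :: "'i \<Rightarrow> 'a \<Rightarrow> real" and a :: "'i \<Rightarrow> real" and f :: "real \<Rightarrow> real"
  assumes M: "prob_space M"
    and Y: "\<And>i. Y i \<in> borel_measurable M" "\<forall>\<^sub>F i in F. AE \<omega> in M. 0 \<le> Y i \<omega>"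
    and a: "\<forall>\<^sub>F i in F. 0 < a i"
    and \<nu>: "sets \<nu> = sets borel" "AE y in \<nu>. 0 \<le> y"
      "\<And>k::nat. integrable \<nu> (\<lambda>y. 1 - exp (- real k * y))"
    and lim: "\<And>k::nat. ((\<lambda>i. (\<integral>\<omega>. 1 - exp (- real k * Y i \<omega>) \<partial>M) / a i) \<longlongrightarrow>
      (\<integral>y. 1 - exp (- real k * y) \<partial>\<nu>)) F"
    and f: "continuous_on UNIV f"
  shows "((\<lambda>i. (\<integral>\<omega>. (1 - exp (- Y i \<omega>)) * f (exp (- Y i \<omega>)) \<partial>M) / a i) \<longlongrightarrow>
      (\<integral>y. (1 - exp (- y)) * f (exp (- y)) \<partial>\<nu>)) F"
proof -
  interpret prob_space M by (rule M)
  have f_meas[measurable]: "f \<in> borel_measurable borel"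
    using f by (rule borel_measurable_continuous_onI)
  have id_meas: "(\<lambda>y. y) \<in> borel_measurable \<nu>"
    using \<nu>(1) by (simp cong: measurable_cong_sets)
  define T where "T i h = (\<integral>\<omega>. (1 - exp (- Y i \<omega>)) * h (exp (- Y i \<omega>)) \<partial>M) / a i" for i h
  define L where "L h = (\<integral>y. (1 - exp (- y)) * h (exp (- y)) \<partial>\<nu>)" for h :: "real \<Rightarrow> real"
  define B where "B = (\<integral>y. 1 - exp (- y) \<partial>\<nu>)"
  have B: "B \<ge> 0" unfolding B_def using \<nu>(2) by (intro integral_nonneg_AE) (auto elim: eventually_mono)
  have limB: "((\<lambda>i. (\<integral>\<omega>. 1 - exp (- Y i \<omega>) \<partial>M) / a i) \<longlongrightarrow> B) F"
    using lim[of 1] by (simp add: B_def)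
  have Y_int: "integrable M (\<lambda>\<omega>. 1 - exp (- real k * Y i \<omega>))" if "AE \<omega> in M. 0 \<le> Y i \<omega>" for i and k :: nat
    using Y(1) by (intro integrable_const_bound[of _ 1]) (use that in \<open>auto elim!: eventually_mono\<close>)
  have "((\<lambda>i. T i f) \<longlongrightarrow> L f) F"
  proof (rule tendstoI)
    fix \<epsilon> :: real assume \<epsilon>: "\<epsilon> > 0"
    \<comment> \<open>Replacing \<open>f\<close> by the polynomial costs e (B + 1) under
      \<open>Y i\<close> and e B in the limit; convergence on the polynomial costs a further e. The
      total e (2 B + 2) equals \<epsilon> / 2.\<close>
    define e where "e = \<epsilon> / (2 * (2 * B + 2))"
    have e: "e > 0" "e * (2 * B + 2) < \<epsilon>" using \<epsilon> B by (auto simp: e_def divide_simps add_pos_nonneg)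
    obtain c and n :: nat where c: "\<And>u. u \<in> {0..1} \<Longrightarrow> \<bar>f u - (\<Sum>i\<le>n. c i * u ^ i)\<bar> \<le> e"
      using weierstrass_unit_interval[OF f e(1)] by blast
    define g where "g u = (\<Sum>i\<le>n. c i * u ^ i)" for u
    have "\<bar>L f - L g\<bar> \<le> e * B"
      unfolding L_def g_def B_def
      by (rule integral_laplace_approx(2)[OF _ id_meas f_meas integral_laplace_polynomial(1)[OF \<nu>(3)] \<nu>(2) c])
         (use \<nu>(3)[of 1] in auto)
    have "((\<lambda>i. \<Sum>j\<le>n. c j * ((\<integral>\<omega>. 1 - exp (- real (Suc j) * Y i \<omega>) \<partial>M) / a i - (\<integral>\<omega>. 1 - exp (- real j * Y i \<omega>) \<partial>M) / a i))
       \<longlongrightarrow> (\<Sum>j\<le>n. c j * ((\<integral>y. 1 - exp (- real (Suc j) * y) \<partial>\<nu>) - (\<integral>y. 1 - exp (- real j * y) \<partial>\<nu>)))) F"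
      by (intro tendsto_intros lim)
    also have "(\<Sum>j\<le>n. c j * ((\<integral>y. 1 - exp (- real (Suc j) * y) \<partial>\<nu>) - (\<integral>y. 1 - exp (- real j * y) \<partial>\<nu>))) = L g"
      unfolding L_def g_def by (rule integral_laplace_polynomial(2)[OF \<nu>(3), symmetric])
    finally have lim_g: "((\<lambda>i. \<Sum>j\<le>n. c j * ((\<integral>\<omega>. 1 - exp (- real (Suc j) * Y i \<omega>) \<partial>M) / a i - (\<integral>\<omega>. 1 - exp (- real j * Y i \<omega>) \<partial>M) / a i))
       \<longlongrightarrow> L g) F" .
    have "\<forall>\<^sub>F i in F. dist (\<Sum>j\<le>n. c j * ((\<integral>\<omega>. 1 - exp (- real (Suc j) * Y i \<omega>) \<partial>M) / a i - (\<integral>\<omega>. 1 - exp (- real j * Y i \<omega>) \<partial>M) / a i)) (L g) < e"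
      by (rule tendstoD[OF lim_g e(1)])
    moreover have "\<forall>\<^sub>F i in F. (\<integral>\<omega>. 1 - exp (- Y i \<omega>) \<partial>M) / a i < B + 1"
      by (rule order_tendstoD(2)[OF limB]) simp
    ultimately show "\<forall>\<^sub>F i in F. dist (T i f) (L f) < \<epsilon>"
      using Y(2) a
    proof eventually_elim
      case (elim i)
      note pi = integral_laplace_polynomial[OF Y_int[OF elim(3)]]
      have Tg: "T i g = (\<Sum>j\<le>n. c j * ((\<integral>\<omega>. 1 - exp (- real (Suc j) * Y i \<omega>) \<partial>M) / a i - (\<integral>\<omega>. 1 - exp (- real j * Y i \<omega>) \<partial>M) / a i))"
        unfolding T_def g_def pi(2) sum_divide_distrib by (simp add: diff_divide_distrib[symmetric])
      have "\<bar>(\<integral>\<omega>. (1 - exp (- Y i \<omega>)) * f (exp (- Y i \<omega>)) \<partial>M) - (\<integral>\<omega>. (1 - exp (- Y i \<omega>)) * g (exp (- Y i \<omega>)) \<partial>M)\<bar>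
        \<le> e * (\<integral>\<omega>. 1 - exp (- Y i \<omega>) \<partial>M)"
        unfolding g_def
        by (rule integral_laplace_approx(2)[OF _ Y(1) f_meas pi(1) elim(3) c])
           (use Y_int[OF elim(3), of 1] in auto)
      hence "\<bar>T i f - T i g\<bar> \<le> e * (\<integral>\<omega>. 1 - exp (- Y i \<omega>) \<partial>M) / a i"
        using elim(4) unfolding T_def diff_divide_distrib[symmetric]
        by (simp add: divide_right_mono)
      also have "\<dots> = e * ((\<integral>\<omega>. 1 - exp (- Y i \<omega>) \<partial>M) / a i)" by simp
      also have "\<dots> \<le> e * (B + 1)" using e elim(2) by (intro mult_left_mono) auto
      finally have "\<bar>T i f - T i g\<bar> \<le> e * (B + 1)" .
      moreover have "\<bar>T i g - L g\<bar> < e" using elim(1) unfolding Tg dist_real_def .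
      ultimately have "\<bar>T i f - L f\<bar> < e * (B + 1) + e + e * B"
        using \<open>\<bar>L f - L g\<bar> \<le> e * B\<close> by linarith
      also have "\<dots> = e * (2 * B + 2)" by (simp add: algebra_simps)
      finally show ?case using e(2) by (simp add: dist_real_def)
    qed
  qed
  thus ?thesis by (simp add: T_def L_def)
qed

section \<open>From continuous test functions to tails\<close>

text \<open>A linear ramp in u = exp(-y), falling from 1 at p to 0 at q, hence increasing in y.
  Taking q < 1 keeps its support away from y = 0, where the limit measure may have infinite
  mass.\<close>

definition cutoff :: "real \<Rightarrow> real \<Rightarrow> real \<Rightarrow> real" where
  "cutoff p q u = max 0 (min 1 ((q - u) / (q - p)))"

lemma cutoff_bounds:
  assumes "p < q"
  shows "0 \<le> cutoff p q u" "cutoff p q u \<le> 1" "u \<le> p \<Longrightarrow> cutoff p q u = 1" "q \<le> u \<Longrightarrow> cutoff p q u = 0"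
  using assms by (auto simp: cutoff_def field_simps)

text \<open>Dividing by 1 - u cancels the weight. The \<open>max\<close> with 1 - q keeps the
  quotient continuous at u = 1 and changes nothing where the cutoff is nonzero, since there u <
  q.\<close>

lemma cutoff_quotient:
  assumes "p < q" "q < 1" "0 \<le> y"
  shows "(1 - exp (- y)) * (cutoff p q (exp (- y)) / max (1 - exp (- y)) (1 - q)) = cutoff p q (exp (- y))"
proof (cases "exp (- y) < q")
  case True
  hence "max (1 - exp (- y)) (1 - q) = 1 - exp (- y)" "1 - exp (- y) > 0" using assms(2) by linarith+
  thus ?thesis by simp
next
  case False thus ?thesis using cutoff_bounds(4)[OF assms(1)] by simp
qed

lemma cutoff_tendsto:
  fixes Y :: "'i \<Rightarrow> 'a \<Rightarrow> real" and a :: "'i \<Rightarrow> real"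
  assumes M: "prob_space M"
    and Y: "\<And>i. Y i \<in> borel_measurable M" "\<forall>\<^sub>F i in F. AE \<omega> in M. 0 \<le> Y i \<omega>"
    and a: "\<forall>\<^sub>F i in F. 0 < a i"
    and \<nu>: "sets \<nu> = sets borel" "AE y in \<nu>. 0 \<le> y"
      "\<And>k::nat. integrable \<nu> (\<lambda>y. 1 - exp (- real k * y))"
    and lim: "\<And>k::nat. ((\<lambda>i. (\<integral>\<omega>. 1 - exp (- real k * Y i \<omega>) \<partial>M) / a i) \<longlongrightarrow>
      (\<integral>y. 1 - exp (- real k * y) \<partial>\<nu>)) F"
    and pq: "p < q" "q < 1"
  shows "((\<lambda>i. (\<integral>\<omega>. cutoff p q (exp (- Y i \<omega>)) \<partial>M) / a i) \<longlongrightarrow> (\<integral>y. cutoff p q (exp (- y)) \<partial>\<nu>)) F"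
proof -
  let ?f = "\<lambda>u. cutoff p q u / max (1 - u) (1 - q)"
  have f: "continuous_on UNIV ?f"
    unfolding cutoff_def using pq by (intro continuous_intros) (auto simp: max_def)
  have [measurable]: "cutoff p q \<in> borel_measurable borel" unfolding cutoff_def by measurable
  note [measurable] = Y(1)
  have [measurable]: "(\<lambda>y. y) \<in> borel_measurable \<nu>"
    using \<nu>(1) by (simp cong: measurable_cong_sets)
  have L: "(\<integral>y. (1 - exp (- y)) * ?f (exp (- y)) \<partial>\<nu>) = (\<integral>y. cutoff p q (exp (- y)) \<partial>\<nu>)"
    using \<nu>(2) cutoff_quotient[OF pq] by (intro integral_cong_AE) (auto elim!: eventually_mono)
  show ?thesis
    using laplace_functional_tendsto[OF M Y a \<nu> lim f] unfolding L
  proof (rule Lim_transform_eventually)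
    show "\<forall>\<^sub>F i in F. (\<integral>\<omega>. (1 - exp (- Y i \<omega>)) * ?f (exp (- Y i \<omega>)) \<partial>M) / a i = (\<integral>\<omega>. cutoff p q (exp (- Y i \<omega>)) \<partial>M) / a i"
      using Y(2)
    proof eventually_elim
      case (elim i)
      have "(\<integral>\<omega>. (1 - exp (- Y i \<omega>)) * ?f (exp (- Y i \<omega>)) \<partial>M) = (\<integral>\<omega>. cutoff p q (exp (- Y i \<omega>)) \<partial>M)"
        using elim cutoff_quotient[OF pq] by (intro integral_cong_AE) (auto elim!: eventually_mono)
      thus ?case by simp
    qed
  qed
qed

text \<open>The indicator of y > 1 is discontinuous, so it is squeezed between cutoffs whose ramps
  end or begin at 1; continuity of \<open>G\<close> at 1 closes the gap. Finiteness of the tails of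
  \<nu> makes the cutoffs integrable.\<close>

lemma tail_tendsto_of_laplace_tendsto:
  fixes Y :: "'i \<Rightarrow> 'a \<Rightarrow> real" and a :: "'i \<Rightarrow> real"
  assumes M: "prob_space M"
    and Y: "\<And>i. Y i \<in> borel_measurable M" "\<forall>\<^sub>F i in F. AE \<omega> in M. 0 \<le> Y i \<omega>"
    and a: "\<forall>\<^sub>F i in F. 0 < a i"
    and \<nu>: "sets \<nu> = sets borel" "AE y in \<nu>. 0 \<le> y"
      "\<And>k::nat. integrable \<nu> (\<lambda>y. 1 - exp (- real k * y))"
    and lim: "\<And>k::nat. ((\<lambda>i. (\<integral>\<omega>. 1 - exp (- real k * Y i \<omega>) \<partial>M) / a i) \<longlongrightarrow>
      (\<integral>y. 1 - exp (- real k * y) \<partial>\<nu>)) F"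
    and G: "\<And>y. y > 0 \<Longrightarrow> emeasure \<nu> {y<..} = ennreal (G y)" "\<And>y. y > 0 \<Longrightarrow> 0 \<le> G y" "isCont G 1"
  shows "((\<lambda>i. measure M {\<omega>\<in>space M. 1 < Y i \<omega>} / a i) \<longlongrightarrow> G 1) F"
proof -
  interpret prob_space M by (rule M)
  have [measurable]: "cutoff p q \<in> borel_measurable borel" for p q unfolding cutoff_def by measurable
  note [measurable] = Y(1)
  have id_meas[measurable]: "(\<lambda>y. y) \<in> borel_measurable \<nu>"
    using \<nu>(1) by (simp cong: measurable_cong_sets)
  have sp: "space \<nu> = UNIV" using sets_eq_imp_space_eq[OF \<nu>(1)] by simp
  have meas_iv: "{y<..} \<in> sets \<nu>" for y :: real using \<nu>(1) by simp
  have tail_int: "integrable \<nu> (indicat_real {y<..})" "(\<integral>x. indicat_real {y<..} x \<partial>\<nu>) = G y" if "y > 0" for y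
    using G(1,2)[OF that] meas_iv sp by (auto simp: integrable_indicator_iff measure_def)
  have cut_int: "integrable \<nu> (\<lambda>y. cutoff p q (exp (- y)))" if "p < q" "0 < q" "q < 1" for p q
  proof (rule Bochner_Integration.integrable_bound[OF tail_int(1)])
    show "- ln q > 0" using that by (simp add: ln_less_zero_iff)
    show "AE x in \<nu>. norm (cutoff p q (exp (- x))) \<le> norm (indicat_real {- ln q<..} x)"
    proof (rule AE_I2)
      fix x
      have "- x < ln q" if "cutoff p q (exp (- x)) \<noteq> 0"
      proof -
        have "exp (- x) < q" using that cutoff_bounds(4)[OF \<open>p < q\<close>, of "exp (- x)"] by (meson not_le)
        thus ?thesis using \<open>0 < q\<close> ln_less_cancel_iff[of "exp (- x)" q] by simp
      qed
      thus "norm (cutoff p q (exp (- x))) \<le> norm (indicat_real {- ln q<..} x)"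
        using cutoff_bounds(1,2)[OF \<open>p < q\<close>, of "exp (- x)"]
        by (cases "cutoff p q (exp (- x)) = 0") (auto simp: indicator_def)
    qed
  qed simp
  have cut_int_M: "integrable M (\<lambda>\<omega>. cutoff p q (exp (- Y i \<omega>)))" if "p < q" for p q i
    using cutoff_bounds(1,2)[OF that] by (intro integrable_const_bound[of _ 1]) auto
  have prob_eq: "measure M {\<omega>\<in>space M. 1 < Y i \<omega>} = (\<integral>\<omega>. indicator {\<omega>\<in>space M. 1 < Y i \<omega>} \<omega> \<partial>M)" for i
    by simp
  have ind_int: "integrable M (indicat_real {\<omega>\<in>space M. 1 < Y i \<omega>})" for i
    by (intro integrable_real_indicator) (auto simp: emeasure_eq_measure)
  show ?thesis
  proof (rule order_tendstoI)
    fix l assume "l < G 1"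
    have "\<forall>\<^sub>F y in at_right 1. l < G y"
      using order_tendstoD(1)[OF G(3)[unfolded isCont_def] \<open>l < G 1\<close>] by (simp add: eventually_at_split)
    then obtain b where b: "b > 1" "l < G b"
      using eventually_happens'[OF _ eventually_conj[OF _ eventually_at_right_less[of 1]]]
      by (metis trivial_limit_at_right_real)
    \<comment> \<open>In the variable y the ramp runs from 1 up to b > 1, so this cutoff lies above
      the indicator of y > b and below that of y > 1.\<close>
    define p q :: real where "p = exp (- b)" and "q = exp (- 1)"
    have pq: "p < q" "0 < q" "q < 1" using b by (auto simp: p_def q_def)
    have "G b = (\<integral>y. indicat_real {b<..} y \<partial>\<nu>)" using tail_int b by simp
    also have "\<dots> \<le> (\<integral>y. cutoff p q (exp (- y)) \<partial>\<nu>)"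
      using b pq by (intro integral_mono tail_int cut_int)
        (auto simp: indicator_def cutoff_bounds p_def)
    finally have "l < (\<integral>y. cutoff p q (exp (- y)) \<partial>\<nu>)" using b by simp
    from order_tendstoD(1)[OF cutoff_tendsto[OF M Y a \<nu> lim pq(1,3)] this] a
    show "\<forall>\<^sub>F i in F. l < measure M {\<omega>\<in>space M. 1 < Y i \<omega>} / a i"
    proof eventually_elim
      case (elim i)
      have "(\<integral>\<omega>. cutoff p q (exp (- Y i \<omega>)) \<partial>M) \<le> (\<integral>\<omega>. indicator {\<omega>\<in>space M. 1 < Y i \<omega>} \<omega> \<partial>M)"
      proof (intro integral_mono cut_int_M pq ind_int)
        fix \<omega> assume "\<omega> \<in> space M"
        thus "cutoff p q (exp (- Y i \<omega>)) \<le> indicator {\<omega>\<in>space M. 1 < Y i \<omega>} \<omega>"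
          using cutoff_bounds(2,4)[OF pq(1), of "exp (- Y i \<omega>)"]
          by (auto simp: indicator_def q_def not_less)
      qed
      with elim show ?case unfolding prob_eq by (meson divide_right_mono less_imp_le less_le_trans)
    qed
  next
    fix l assume "G 1 < l"
    have "\<forall>\<^sub>F y in at_left 1. G y < l"
      using order_tendstoD(2)[OF G(3)[unfolded isCont_def] \<open>G 1 < l\<close>] by (simp add: eventually_at_split)
    moreover have "\<forall>\<^sub>F y in at_left (1::real). 0 < y"
      by (rule eventually_at_left_field[THEN iffD2]) (auto intro!: exI[of _ 0])
    moreover have "\<forall>\<^sub>F y in at_left (1::real). y < 1"
      by (rule eventually_at_left_field[THEN iffD2]) (auto intro!: exI[of _ 0])
    ultimately have "\<forall>\<^sub>F y in at_left 1. G y < l \<and> 0 < y \<and> y < 1" by (intro eventually_conj)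
    then obtain b where b: "0 < b" "b < 1" "G b < l"
      using eventually_happens'[OF trivial_limit_at_left_real] by blast
    \<comment> \<open>Now the ramp runs from b < 1 up to 1, so the cutoff lies above the indicator
      of y > 1 and below that of y > b.\<close>
    define p q :: real where "p = exp (- 1)" and "q = exp (- b)"
    have pq: "p < q" "0 < q" "q < 1" using b by (auto simp: p_def q_def)
    have "(\<integral>y. cutoff p q (exp (- y)) \<partial>\<nu>) \<le> (\<integral>y. indicat_real {b<..} y \<partial>\<nu>)"
    proof (intro integral_mono tail_int cut_int b pq)
      fix y show "cutoff p q (exp (- y)) \<le> indicat_real {b<..} y"
        using cutoff_bounds(2,4)[OF pq(1), of "exp (- y)"] by (auto simp: indicator_def q_def not_less)
    qed
    also have "\<dots> = G b" using tail_int b by simp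
    finally have "(\<integral>y. cutoff p q (exp (- y)) \<partial>\<nu>) < l" using b by simp
    from order_tendstoD(2)[OF cutoff_tendsto[OF M Y a \<nu> lim pq(1,3)] this] a
    show "\<forall>\<^sub>F i in F. measure M {\<omega>\<in>space M. 1 < Y i \<omega>} / a i < l"
    proof eventually_elim
      case (elim i)
      have "(\<integral>\<omega>. indicator {\<omega>\<in>space M. 1 < Y i \<omega>} \<omega> \<partial>M) \<le> (\<integral>\<omega>. cutoff p q (exp (- Y i \<omega>)) \<partial>M)"
        using pq cutoff_bounds by (intro integral_mono cut_int_M pq ind_int) (auto simp: indicator_def p_def)
      with elim show ?case unfolding prob_eq by (meson divide_right_mono less_imp_le le_less_trans)
    qed
  qed
qed

section \<open>Laplace transforms and power tails\<close>

text \<open>Substituting v = t / s gives Euler's integral for Gamma(1 - a), which converges at 0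
  because a < 1. All Gamma factors of the final constant originate here.\<close>

lemma nn_integral_powr_exponential:
  fixes s a :: real
  assumes "s > 0" "a < 1"
  shows "(\<integral>\<^sup>+v. ennreal (v powr (-a)) \<partial>density lborel (exponential_density s)) = ennreal (Gamma (1 - a) * s powr a)"
proof -
  have "(\<integral>\<^sup>+v. ennreal (v powr (-a)) \<partial>density lborel (exponential_density s))
    = (\<integral>\<^sup>+v. ennreal (exponential_density s v) * ennreal (v powr (-a)) \<partial>lborel)"
    by (subst nn_integral_density) auto
  also have "\<dots> = ennreal \<bar>1 / s\<bar> * (\<integral>\<^sup>+t. ennreal (exponential_density s (0 + 1 / s * t)) * ennreal ((0 + 1 / s * t) powr (-a)) \<partial>lborel)"
    by (rule nn_integral_real_affine) (use assms in auto)
  also have "\<dots> = ennreal \<bar>1 / s\<bar> * (\<integral>\<^sup>+t. ennreal (s * s powr a) * ennreal (indicator {0..} t * t powr ((1 - a) - 1) / exp t) \<partial>lborel)"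
  proof -
    have "ennreal (exponential_density s (0 + 1 / s * t)) * ennreal ((0 + 1 / s * t) powr (-a))
      = ennreal (s * s powr a) * ennreal (indicator {0..} t * t powr ((1 - a) - 1) / exp t)" for t
      using assms
      by (cases "t < 0")
        (auto simp: exponential_density_def ennreal_mult[symmetric] powr_divide powr_minus exp_minus field_simps divide_neg_pos
          simp del: ennreal_mult)
    thus ?thesis by simp
  qed
  also have "\<dots> = ennreal (1 / s) * (ennreal (s * s powr a) * ennreal (Gamma (1 - a)))"
    using assms by (subst nn_integral_cmult) (auto simp: Gamma_conv_nn_integral_real)
  also have "\<dots> = ennreal (Gamma (1 - a) * s powr a)"
    using assms Gamma_real_pos[of "1 - a"] by (simp add: ennreal_mult[symmetric] field_simps del: ennreal_mult)
  finally show ?thesis .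
qed

lemma integral_powr_exponential:
  fixes s a :: real
  assumes "s > 0" "a < 1"
  shows "integrable (density lborel (exponential_density s)) (\<lambda>v. v powr (-a))"
    and "(\<integral>v. v powr (-a) \<partial>density lborel (exponential_density s)) = Gamma (1 - a) * s powr a"
proof -
  have G: "Gamma (1 - a) * s powr a \<ge> 0" using assms Gamma_real_pos[of "1 - a"] by simp
  have "has_bochner_integral (density lborel (exponential_density s)) (\<lambda>v. v powr (-a)) (Gamma (1 - a) * s powr a)"
    by (rule has_bochner_integral_nn_integral) (use G nn_integral_powr_exponential[OF assms] in auto)
  thus "integrable (density lborel (exponential_density s)) (\<lambda>v. v powr (-a))"
    "(\<integral>v. v powr (-a) \<partial>density lborel (exponential_density s)) = Gamma (1 - a) * s powr a"
    by (auto simp: has_bochner_integral_iff)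
qed

text \<open>Fubini on the set \<open>v < y\<close>: the exponential law gives mass \<open>1 - exp (- s * y)\<close> to \<open>{..<y}\<close>.\<close>

lemma nn_integral_laplace_tail:
  assumes "sigma_finite_measure \<nu>" and sets_\<nu>[measurable_cong]: "sets \<nu> = sets borel" and s: "s > 0"
  shows "(\<integral>\<^sup>+y. ennreal (1 - exp (- s * max 0 y)) \<partial>\<nu>) =
    (\<integral>\<^sup>+v. emeasure \<nu> {v<..} \<partial>density lborel (exponential_density s))"
proof -
  let ?E = "density lborel (exponential_density s)"
  interpret \<nu>: sigma_finite_measure \<nu> by fact
  interpret E: prob_space ?E using s by (rule prob_space_exponential_density)
  interpret pair_sigma_finite ?E \<nu> ..
  let ?S = "{p \<in> space (?E \<Otimes>\<^sub>M \<nu>). fst p < snd p}"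
  have sp: "space \<nu> = UNIV" using sets_eq_imp_space_eq[OF sets_\<nu>] by simp
  have S: "?S \<in> sets (?E \<Otimes>\<^sub>M \<nu>)" by measurable
  have "(\<integral>\<^sup>+v. emeasure \<nu> (Pair v -` ?S) \<partial>?E) = (\<integral>\<^sup>+y. emeasure ?E ((\<lambda>x. (x, y)) -` ?S) \<partial>\<nu>)"
    using \<nu>.emeasure_pair_measure_alt[OF S] emeasure_pair_measure_alt2[OF S] by simp
  moreover have "Pair v -` ?S = {v<..}" for v
    using sp by (auto simp: space_pair_measure)
  moreover have "(\<lambda>x. (x, y)) -` ?S = {..<y}" for y
    using sp by (auto simp: space_pair_measure)
  moreover have "emeasure ?E {..<y} = ennreal (1 - exp (- s * max 0 y))" for y
  proof -
    have "AE x in lborel. x \<noteq> y" by (rule AE_lborel_singleton)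
    hence "emeasure ?E {..<y} = emeasure ?E {..y}"
      by (intro emeasure_eq_AE) (auto simp: AE_density elim!: eventually_mono)
    also have "\<dots> = ennreal (1 - exp (- s * max 0 y))"
      using s by (simp add: emeasure_erlang_density erlang_CDF_0 max_def)
    finally show ?thesis .
  qed
  ultimately show ?thesis by simp
qed

lemma tail_prob_antimono:
  assumes "prob_space M" "X \<in> borel_measurable M"
  shows "antimono (tail_prob M X)"
proof (rule antimonoI)
  interpret prob_space M by fact
  fix x y :: real assume "x \<le> y"
  thus "tail_prob M X y \<le> tail_prob M X x"
    unfolding tail_prob_def using assms(2) by (intro finite_measure_mono) auto
qed

lemma antimono_borel_measurable:
  fixes G :: "real \<Rightarrow> real"
  assumes "antimono G"
  shows "G \<in> borel_measurable borel"
proof -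
  have "mono (\<lambda>x. - G x)" using assms by (auto simp: mono_def antimono_def)
  from borel_measurable_uminus[OF borel_measurable_mono[OF this]] show ?thesis by simp
qed

text \<open>Both sides are the probability that X exceeds an independent exponential variable of
  rate s. The right-hand form has the tail under the integral, where regular variation can be used
  pointwise.\<close>

lemma (in prob_space) laplace_eq_tail_integral:
  assumes [measurable]: "X \<in> borel_measurable M" and nonneg: "AE \<omega> in M. 0 \<le> X \<omega>" and s: "s > 0"
  shows "(\<integral>\<omega>. 1 - exp (- s * X \<omega>) \<partial>M) = (\<integral>v. tail_prob M X v \<partial>density lborel (exponential_density s))"
proof -
  let ?E = "density lborel (exponential_density s)"
  interpret D: prob_space "distr M borel X" by (rule prob_space_distr) measurable
  have [measurable]: "tail_prob M X \<in> borel_measurable borel"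
    by (rule antimono_borel_measurable[OF tail_prob_antimono]) (unfold_locales, measurable)
  have eq: "emeasure (distr M borel X) {v<..} = ennreal (tail_prob M X v)" for v
    by (subst emeasure_distr) (auto simp: tail_prob_def emeasure_eq_measure vimage_def Int_def conj_commute)
  have "(\<integral>\<omega>. 1 - exp (- s * X \<omega>) \<partial>M) = enn2real (\<integral>\<^sup>+\<omega>. ennreal (1 - exp (- s * X \<omega>)) \<partial>M)"
    using nonneg s by (intro integral_eq_nn_integral) (auto elim!: eventually_mono)
  \<comment> \<open>The Fubini identity truncates y at 0 because the exponential law has no mass on
    the negative axis; for the almost surely nonnegative X the truncation changes nothing.\<close>
  also have "(\<integral>\<^sup>+\<omega>. ennreal (1 - exp (- s * X \<omega>)) \<partial>M) = (\<integral>\<^sup>+\<omega>. ennreal (1 - exp (- s * max 0 (X \<omega>))) \<partial>M)"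
    using nonneg by (intro nn_integral_cong_AE) (auto elim!: eventually_mono)
  also have "\<dots> = (\<integral>\<^sup>+y. ennreal (1 - exp (- s * max 0 y)) \<partial>distr M borel X)"
    by (subst nn_integral_distr) auto
  also have "\<dots> = (\<integral>\<^sup>+v. ennreal (tail_prob M X v) \<partial>?E)"
    using nn_integral_laplace_tail[OF D.sigma_finite_measure_axioms _ s] by (simp add: eq)
  also have "enn2real \<dots> = (\<integral>v. tail_prob M X v \<partial>?E)"
    by (intro integral_eq_nn_integral[symmetric]) (auto simp: tail_prob_def)
  finally show ?thesis .
qed

section \<open>The limit measure and Karamata's theorem\<close>

text \<open>For 0 < \<rho> < 1 this is the Levy measure of a \<rho>-stable subordinator, with the
  density scaled so that the tail is exactly \<open>K * x powr (- \<rho>)\<close>.\<close>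

definition stable_measure :: "real \<Rightarrow> real \<Rightarrow> real measure" where
  "stable_measure K \<rho> = density lborel (\<lambda>y. ennreal (indicator {0<..} y * (K * \<rho> * y powr (- \<rho> - 1))))"

lemma stable_measure_tail:
  assumes "0 \<le> K" "0 < \<rho>" "0 < x"
  shows "emeasure (stable_measure K \<rho>) {x<..} = ennreal (K * x powr (- \<rho>))"
proof -
  have "emeasure (stable_measure K \<rho>) {x<..} =
    (\<integral>\<^sup>+y. ennreal (indicator {0<..} y * (K * \<rho> * y powr (- \<rho> - 1))) * indicator {x<..} y \<partial>lborel)"
    unfolding stable_measure_def by (subst emeasure_density) auto
  also have "\<dots> = (\<integral>\<^sup>+y. ennreal (K * \<rho> * y powr (- \<rho> - 1)) * indicator {x..} y \<partial>lborel)"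
    using AE_lborel_singleton[of x] assms(3)
    by (intro nn_integral_cong_AE) (auto elim!: eventually_mono simp: indicator_def)
  also have "\<dots> = ennreal (0 - (- K * x powr (- \<rho>)))"
  proof (rule nn_integral_FTC_atLeast)
    fix y assume "x \<le> y"
    hence "y > 0" using assms by simp
    show "((\<lambda>y. - K * y powr (- \<rho>)) has_real_derivative K * \<rho> * y powr (- \<rho> - 1)) (at y)"
      using \<open>y > 0\<close> by (auto intro!: derivative_eq_intros)
    show "0 \<le> K * \<rho> * y powr (- \<rho> - 1)" using assms by simp
  next
    have "((\<lambda>y. - K * y powr (- \<rho>)) \<longlongrightarrow> - K * 0) at_top"
      using assms by (intro tendsto_intros tendsto_neg_powr filterlim_ident) auto
    thus "((\<lambda>y. - K * y powr (- \<rho>)) \<longlongrightarrow> 0) at_top" by simp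
  qed measurable
  finally show ?thesis by simp
qed

lemma sets_stable_measure[measurable_cong, simp]: "sets (stable_measure K \<rho>) = sets borel"
  by (simp add: stable_measure_def)

lemma AE_stable_measure_pos: "AE y in stable_measure K \<rho>. 0 < y"
  unfolding stable_measure_def by (subst AE_density) (auto simp: indicator_def)

text \<open>The Fubini identity for the exponential law reduces the claim to the power tail and the
  Gamma integral; \<rho> < 1 makes it finite. The value s = 0 is covered because the integer
  frequencies of the Tauberian argument start at 0.\<close>

lemma stable_measure_laplace:
  assumes "0 \<le> K" "0 < \<rho>" "\<rho> < 1" "0 \<le> s"
  shows "integrable (stable_measure K \<rho>) (\<lambda>y. 1 - exp (- s * y))"
    and "(\<integral>y. 1 - exp (- s * y) \<partial>stable_measure K \<rho>) = K * Gamma (1 - \<rho>) * s powr \<rho>"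
proof -
  have hb: "has_bochner_integral (stable_measure K \<rho>) (\<lambda>y. 1 - exp (- s * y)) (K * Gamma (1 - \<rho>) * s powr \<rho>)"
  proof (cases "s = 0")
    case True thus ?thesis using has_bochner_integral_zero by simp
  next
    case False
    hence s: "s > 0" using assms by simp
    let ?E = "density lborel (exponential_density s)"
    have "sigma_finite_measure (stable_measure K \<rho>)"
      unfolding stable_measure_def by (subst sigma_finite_measure.sigma_finite_iff_density_finite[OF sigma_finite_lborel]) auto
    note nn = nn_integral_laplace_tail[OF this _ s]
    have "(\<integral>\<^sup>+y. ennreal (1 - exp (- s * y)) \<partial>stable_measure K \<rho>) =
      (\<integral>\<^sup>+y. ennreal (1 - exp (- s * max 0 y)) \<partial>stable_measure K \<rho>)"
      using AE_stable_measure_pos[of K \<rho>] by (intro nn_integral_cong_AE) (auto elim!: eventually_mono)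
    also have "\<dots> = (\<integral>\<^sup>+v. emeasure (stable_measure K \<rho>) {v<..} \<partial>?E)" by (rule nn) simp
    also have "\<dots> = (\<integral>\<^sup>+v. ennreal K * ennreal (v powr (- \<rho>)) \<partial>?E)"
    proof (intro nn_integral_cong_AE)
      have "AE v in lborel. v \<noteq> (0::real)" by (rule AE_lborel_singleton)
      thus "AE v in ?E. emeasure (stable_measure K \<rho>) {v<..} = ennreal K * ennreal (v powr (- \<rho>))"
        using assms stable_measure_tail[OF assms(1,2)]
        by (auto simp: AE_density exponential_density_def ennreal_mult[symmetric] elim!: eventually_mono simp del: ennreal_mult)
    qed
    also have "\<dots> = ennreal K * ennreal (Gamma (1 - \<rho>) * s powr \<rho>)"
      using nn_integral_powr_exponential[OF s assms(3)] by (subst nn_integral_cmult) auto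
    also have "\<dots> = ennreal (K * Gamma (1 - \<rho>) * s powr \<rho>)"
      using assms by (simp add: ennreal_mult'[symmetric] mult.assoc)
    finally show ?thesis
      using AE_stable_measure_pos[of K \<rho>] s assms Gamma_real_pos[of "1 - \<rho>"]
      by (intro has_bochner_integral_nn_integral) (auto elim!: eventually_mono)
  qed
  thus "integrable (stable_measure K \<rho>) (\<lambda>y. 1 - exp (- s * y))"
    "(\<integral>y. 1 - exp (- s * y) \<partial>stable_measure K \<rho>) = K * Gamma (1 - \<rho>) * s powr \<rho>"
    by (auto simp: has_bochner_integral_iff)
qed

text \<open>Time and level are both absorbed into the index \<open>i\<close> and the scaled variable
  \<open>Y i\<close>, so the tail is needed at the single point 1.\<close>

lemma karamata_tauberian:
  fixes Y :: "'i \<Rightarrow> 'a \<Rightarrow> real" and a :: "'i \<Rightarrow> real"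
  assumes M: "prob_space M"
    and Y: "\<And>i. Y i \<in> borel_measurable M" "\<forall>\<^sub>F i in F. AE \<omega> in M. 0 \<le> Y i \<omega>"
    and a: "\<forall>\<^sub>F i in F. 0 < a i"
    and \<rho>: "0 < \<rho>" "\<rho> < 1" and c: "0 \<le> c"
    and lim: "\<And>s. s > 0 \<Longrightarrow> ((\<lambda>i. (\<integral>\<omega>. 1 - exp (- s * Y i \<omega>) \<partial>M) / a i) \<longlongrightarrow> c * s powr \<rho>) F"
  shows "((\<lambda>i. measure M {\<omega>\<in>space M. 1 < Y i \<omega>} / a i) \<longlongrightarrow> c / Gamma (1 - \<rho>)) F"
proof -
  \<comment> \<open>This choice makes the Laplace functional
    \<open>K * Gamma (1 - \<rho>) * s powr \<rho>\<close> of the stable measure equal to the given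
    limit.\<close>
  define K where "K = c / Gamma (1 - \<rho>)"
  have G: "Gamma (1 - \<rho>) > 0" using \<rho> by (intro Gamma_real_pos) auto
  have K: "0 \<le> K" "K * Gamma (1 - \<rho>) = c" using c G by (auto simp: K_def)
  have "((\<lambda>i. measure M {\<omega>\<in>space M. 1 < Y i \<omega>} / a i) \<longlongrightarrow> K * 1 powr (- \<rho>)) F"
  proof (rule tail_tendsto_of_laplace_tendsto[OF M Y a, where \<nu> = "stable_measure K \<rho>" and G = "\<lambda>y. K * y powr (- \<rho>)"])
    show "AE y in stable_measure K \<rho>. 0 \<le> y"
      using AE_stable_measure_pos[of K \<rho>] by eventually_elim simp
    show "integrable (stable_measure K \<rho>) (\<lambda>y. 1 - exp (- real k * y))" for k
      by (rule stable_measure_laplace(1)) (use K \<rho> in auto)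
    show "((\<lambda>i. (\<integral>\<omega>. 1 - exp (- real k * Y i \<omega>) \<partial>M) / a i) \<longlongrightarrow>
      (\<integral>y. 1 - exp (- real k * y) \<partial>stable_measure K \<rho>)) F" for k
      using lim[of "real k"] stable_measure_laplace(2)[OF K(1) \<rho>, of "real k"] K(2)
      by (cases "k = 0") auto
    show "emeasure (stable_measure K \<rho>) {y<..} = ennreal (K * y powr (- \<rho>))" if "y > 0" for y
      by (rule stable_measure_tail) (use K \<rho> that in auto)
    show "0 \<le> K * y powr (- \<rho>)" for y using K by simp
    show "isCont (\<lambda>y. K * y powr (- \<rho>)) 1" by (intro continuous_intros) auto
  qed simp
  thus ?thesis by (simp add: K_def)
qed

section \<open>Regularly varying tails\<close>

lemma reg_var_tail_ratio:
  assumes "reg_var_tail M \<beta> X" "c > 0"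
  shows "((\<lambda>x. tail_prob M X (c * x) / tail_prob M X x) \<longlongrightarrow> c powr (-\<beta>)) at_top"
proof -
  from assms(1) obtain l where l: "slowly_varying l" "\<And>x. x > 0 \<Longrightarrow> tail_prob M X x = x powr (-\<beta>) * l x"
    by (auto simp: reg_var_tail_def)
  have "((\<lambda>x. c powr (-\<beta>) * (l (c * x) / l x)) \<longlongrightarrow> c powr (-\<beta>) * 1) at_top"
    using l(1) assms(2) unfolding slowly_varying_def by (intro tendsto_intros) auto
  moreover have "\<forall>\<^sub>F x in at_top. c powr (-\<beta>) * (l (c * x) / l x) = tail_prob M X (c * x) / tail_prob M X x"
    using eventually_gt_at_top[of 0] by eventually_elim (use assms(2) in \<open>simp add: l(2) powr_mult\<close>)
  ultimately show ?thesis using Lim_transform_eventually by fastforce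
qed

text \<open>Division by zero yields 0, so a tail vanishing at all large points would have ratio 0
  there, whereas the ratio for c = 1 tends to 1. Monotonicity carries positivity at large points
  back to every x.\<close>

lemma reg_var_tail_pos:
  assumes "prob_space M" "X \<in> borel_measurable M" "reg_var_tail M \<beta> X"
  shows "tail_prob M X x > 0"
proof -
  have "\<forall>\<^sub>F y in at_top. 0 < tail_prob M X (1 * y) / tail_prob M X y"
    by (rule order_tendstoD(1)[OF reg_var_tail_ratio[OF assms(3)]]) auto
  from eventually_happens'[OF _ eventually_conj[OF eventually_ge_at_top[of x] this]]
  obtain y where y: "y \<ge> x" "0 < tail_prob M X (1 * y) / tail_prob M X y" by auto
  have "tail_prob M X y \<noteq> 0" using y by auto
  hence "tail_prob M X y > 0" by (simp add: tail_prob_def less_le)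
  also have "tail_prob M X y \<le> tail_prob M X x"
    using antimonoD[OF tail_prob_antimono[OF assms(1,2)] y(1)] .
  finally show ?thesis .
qed

lemma tail_prob_tendsto_0:
  assumes "prob_space M" and [measurable]: "X \<in> borel_measurable M"
  shows "(tail_prob M X \<longlongrightarrow> 0) at_top"
proof -
  interpret prob_space M by fact
  interpret D: prob_space "distr M borel X" by (rule prob_space_distr) measurable
  interpret D: real_distribution "distr M borel X" by unfold_locales auto
  have "((\<lambda>x. 1 - cdf (distr M borel X) x) \<longlongrightarrow> 1 - 1) at_top"
    by (intro tendsto_intros D.cdf_lim_at_top_prob)
  moreover have "1 - cdf (distr M borel X) x = tail_prob M X x" for x
  proof -
    have "cdf (distr M borel X) x = prob {\<omega>\<in>space M. X \<omega> \<le> x}"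
      unfolding cdf_def by (subst measure_distr) (auto simp: vimage_def Int_def conj_commute)
    moreover have "tail_prob M X x = prob (space M - {\<omega>\<in>space M. X \<omega> \<le> x})"
      unfolding tail_prob_def by (rule arg_cong[where f = prob]) auto
    ultimately show ?thesis by (subst (asm) prob_compl) auto
  qed
  ultimately show ?thesis by (simp add: fun_eq_iff)
qed

section \<open>Potter's bound and the Abelian theorem\<close>

text \<open>The halving ratio tends to 2^\<beta> < 2^\<alpha>, so beyond some \<open>x0\<close> each
  halving of the argument raises \<open>G\<close> by a factor of at most 2^\<alpha>. Descending from
  x to v thus costs about (x / v)^\<alpha>; below \<open>x0\<close> only \<open>G\<close> \<le> 1 is
  available. The induction is on the dyadic range of x.\<close>

lemma potter_bound:
  fixes G :: "real \<Rightarrow> real"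
  assumes anti: "antimono G" and pos: "\<And>x. 0 < G x" and le1: "\<And>x. G x \<le> 1"
    and ratio: "((\<lambda>x. G (1 / 2 * x) / G x) \<longlongrightarrow> (1 / 2) powr (-\<beta>)) at_top" and \<alpha>: "\<beta> < \<alpha>" "0 \<le> \<alpha>"
  obtains x0 A where "x0 > 0" "A > 0" "\<And>x v. x0 \<le> x \<Longrightarrow> 0 < v \<Longrightarrow> v \<le> x \<Longrightarrow> G v \<le> A * (x / v) powr \<alpha> * G x"
proof -
  have "(1 / 2) powr (-\<beta>) < (2::real) powr \<alpha>"
    using \<alpha> by (simp add: powr_minus powr_divide divide_simps)
  from order_tendstoD(2)[OF ratio this] obtain x1 where x1: "\<And>x. x \<ge> x1 \<Longrightarrow> G (1 / 2 * x) / G x < 2 powr \<alpha>"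
    by (auto simp: eventually_at_top_linorder)
  define x0 where "x0 = max x1 1"
  have x0: "x0 > 0" "\<And>x. x \<ge> x0 \<Longrightarrow> G (x / 2) \<le> 2 powr \<alpha> * G x"
    using x1 pos by (auto simp: x0_def field_simps less_imp_le)
  \<comment> \<open>The first entry pays for an incomplete last halving, where v > x / 2. The second
    pays for x \<le> 2 x0, where G v \<le> 1 is compared with G x \<ge> G (2 x0).\<close>
  define A where "A = max (2 powr \<alpha>) (1 / G (2 * x0))"
  have A: "A > 0" "2 powr \<alpha> \<le> A" "1 \<le> A * G (2 * x0)"
    using pos[of "2 * x0"] by (auto simp: A_def max_def field_simps)
  have main: "\<forall>x v. x0 \<le> x \<longrightarrow> x \<le> 2 ^ Suc n * x0 \<longrightarrow> 0 < v \<longrightarrow> v \<le> x \<longrightarrow> G v \<le> A * (x / v) powr \<alpha> * G x" for n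
  proof (induction n)
    case 0
    show ?case
    proof (intro allI impI)
      fix x v assume x: "x0 \<le> x" "x \<le> 2 ^ Suc 0 * x0" "0 < v" "v \<le> x"
      have "G v \<le> 1" by (rule le1)
      also have "1 \<le> A * G (2 * x0)" by (rule A)
      also have "\<dots> \<le> A * G x" using x A antimonoD[OF anti, of x "2 * x0"] by simp
      also have "\<dots> \<le> A * (x / v) powr \<alpha> * G x"
        using x A(1) pos[of x] \<alpha> ge_one_powr_ge_zero[of "x / v" \<alpha>] by simp
      finally show "G v \<le> A * (x / v) powr \<alpha> * G x" .
    qed
  next
    case (Suc n)
    show ?case
    proof (intro allI impI)
      fix x v assume x: "x0 \<le> x" "x \<le> 2 ^ Suc (Suc n) * x0" "0 < v" "v \<le> x"
      \<comment> \<open>In the second case x / 2 is still at least \<open>x0\<close> and lies in the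
        previous range. The factor 2^\<alpha> lost by halving is exactly what turns (x / 2 /
        v)^\<alpha> into (x / v)^\<alpha>, so \<open>A\<close> does not grow with n.\<close>
      consider "x \<le> 2 ^ Suc n * x0" | "x > 2 ^ Suc n * x0" "v \<le> x / 2" | "v > x / 2" by linarith
      thus "G v \<le> A * (x / v) powr \<alpha> * G x"
      proof cases
        case 1 thus ?thesis using Suc.IH x by blast
      next
        case 2
        have "2 * x0 \<le> 2 ^ Suc n * x0" using x0 by simp
        hence "x0 \<le> x / 2" using 2 by linarith
        hence "G v \<le> A * (x / 2 / v) powr \<alpha> * G (x / 2)"
          using Suc.IH[rule_format, of "x / 2" v] x 2 by simp
        also have "\<dots> \<le> A * (x / 2 / v) powr \<alpha> * (2 powr \<alpha> * G x)"
          using A x0(2)[OF x(1)] by (intro mult_left_mono) auto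
        also have "\<dots> = A * ((x / 2 / v) powr \<alpha> * 2 powr \<alpha>) * G x" by simp
        also have "(x / 2 / v) powr \<alpha> * 2 powr \<alpha> = (x / v) powr \<alpha>"
          using x x0(1) by (subst powr_mult[symmetric]) auto
        finally show ?thesis .
      next
        case 3
        have "G v \<le> G (x / 2)" using 3 by (intro antimonoD[OF anti]) simp
        also have "\<dots> \<le> 2 powr \<alpha> * G x" by (rule x0(2)[OF x(1)])
        also have "\<dots> \<le> A * G x" using A pos[of x] by simp
        also have "\<dots> \<le> A * (x / v) powr \<alpha> * G x"
          using x A(1) pos[of x] \<alpha> ge_one_powr_ge_zero[of "x / v" \<alpha>] by simp
        finally show ?thesis .
      qed
    qed
  qed
  have "G v \<le> A * (x / v) powr \<alpha> * G x" if "x0 \<le> x" "0 < v" "v \<le> x" for x v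
  proof -
    obtain n where "x / x0 < 2 ^ n" using real_arch_pow[of 2 "x / x0"] by auto
    hence "x < 2 ^ n * x0" using x0(1) by (simp add: pos_divide_less_eq)
    also have "\<dots> \<le> 2 ^ Suc n * x0" using x0(1) by simp
    finally show ?thesis using main[of n] that by (auto dest: less_imp_le)
  qed
  thus ?thesis using that[OF x0(1) A(1)] by blast
qed

text \<open>The quotient equals the mean of \<open>?G (v * x) / ?G x\<close> for v exponential of
  rate 1. The integrand tends to v^(-\<beta>), whose mean is Gamma(1-\<beta>); Potter's bound
  supplies the domination.\<close>

lemma abelian_laplace_tail:
  assumes M: "prob_space M" and X[measurable]: "X \<in> borel_measurable M"
    and nonneg: "AE \<omega> in M. 0 \<le> X \<omega>" and rv: "reg_var_tail M \<beta> X" and \<beta>: "0 < \<beta>" "\<beta> < 1"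
  shows "((\<lambda>x. (\<integral>\<omega>. 1 - exp (- (X \<omega> / x)) \<partial>M) / tail_prob M X x) \<longlongrightarrow> Gamma (1 - \<beta>)) at_top"
proof -
  interpret prob_space M by (rule M)
  let ?G = "tail_prob M X"
  let ?E = "density lborel (exponential_density 1)"
  interpret E: prob_space ?E by (rule prob_space_exponential_density) simp
  note anti = tail_prob_antimono[OF M X]
  note pos = reg_var_tail_pos[OF M X rv]
  have le1: "?G x \<le> 1" for x by (simp add: tail_prob_def)
  have [measurable]: "?G \<in> borel_measurable borel" by (rule antimono_borel_measurable[OF anti])
  have AE_pos: "AE v in ?E. 0 < v"
    using AE_lborel_singleton[of "0::real"]
    by (subst AE_density) (auto simp: exponential_density_def elim!: eventually_mono)
  \<comment> \<open>The exponent must exceed \<beta> for Potter's bound and stay below 1 for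
    v^(-\<alpha>) to be integrable at 0; the midpoint does both.\<close>
  define \<alpha> where "\<alpha> = (1 + \<beta>) / 2"
  have \<alpha>: "\<beta> < \<alpha>" "0 \<le> \<alpha>" "\<alpha> < 1" using \<beta> by (auto simp: \<alpha>_def)
  have half: "((\<lambda>x. ?G (1 / 2 * x) / ?G x) \<longlongrightarrow> (1 / 2) powr (-\<beta>)) at_top"
    by (rule reg_var_tail_ratio[OF rv]) simp
  obtain x0 A where A: "x0 > 0" "A > 0"
    "\<And>x v. x0 \<le> x \<Longrightarrow> 0 < v \<Longrightarrow> v \<le> x \<Longrightarrow> ?G v \<le> A * (x / v) powr \<alpha> * ?G x"
    by (rule potter_bound[OF anti pos le1 half \<alpha>(1,2)]) (rule that)
  \<comment> \<open>In the dominating function the term A v^(-\<alpha>) handles v \<le> 1 by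
    Potter's bound, and the term 1 handles v > 1 by monotonicity of the tail.\<close>
  have "((\<lambda>x. \<integral>v. ?G (v * x) / ?G x \<partial>?E) \<longlongrightarrow> (\<integral>v. v powr (-\<beta>) \<partial>?E)) at_top"
  proof (rule integral_dominated_convergence_at_top[where w = "\<lambda>v. 1 + A * v powr (-\<alpha>)"])
    show "integrable ?E (\<lambda>v. 1 + A * v powr (-\<alpha>))"
      using integral_powr_exponential(1)[of 1 \<alpha>] \<alpha> by simp
    show "AE v in ?E. ((\<lambda>x. ?G (v * x) / ?G x) \<longlongrightarrow> v powr (-\<beta>)) at_top"
      using AE_pos by eventually_elim (rule reg_var_tail_ratio[OF rv])
    show "\<forall>\<^sub>F x in at_top. AE v in ?E. norm (?G (v * x) / ?G x) \<le> 1 + A * v powr (-\<alpha>)"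
      using eventually_ge_at_top[of x0]
    proof eventually_elim
      case (elim x)
      hence x: "x > 0" using A by linarith
      show ?case using AE_pos
      proof eventually_elim
        case (elim v)
        show ?case
        proof (cases "v \<le> 1")
          case True
          have "?G (v * x) \<le> A * (x / (v * x)) powr \<alpha> * ?G x"
            using elim True x \<open>x0 \<le> x\<close> by (intro A) auto
          also have "(x / (v * x)) powr \<alpha> = v powr (-\<alpha>)"
            using x elim by (simp add: powr_divide powr_minus_divide)
          finally have "?G (v * x) / ?G x \<le> A * v powr (-\<alpha>)" using pos[of x] by (simp add: pos_divide_le_eq)
          thus ?thesis using pos[of x] pos[of "v * x"] by simp
        next
          case False
          hence "?G (v * x) \<le> ?G x" using x by (intro antimonoD[OF anti]) auto
          hence "norm (?G (v * x) / ?G x) \<le> 1" using pos[of x] pos[of "v * x"] by (simp add: divide_simps)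
          also have "1 \<le> 1 + A * v powr (-\<alpha>)" using A(2) by simp
          finally show ?thesis .
        qed
      qed
    qed
  qed measurable
  also have "(\<integral>v. v powr (-\<beta>) \<partial>?E) = Gamma (1 - \<beta>)"
    using integral_powr_exponential(2)[of 1 \<beta>] \<beta> by simp
  finally show ?thesis
  proof (rule Lim_transform_eventually)
    show "\<forall>\<^sub>F x in at_top. (\<integral>v. ?G (v * x) / ?G x \<partial>?E) = (\<integral>\<omega>. 1 - exp (- (X \<omega> / x)) \<partial>M) / ?G x"
      using eventually_gt_at_top[of 0]
    proof eventually_elim
      case (elim x)
      have "(\<integral>\<omega>. 1 - exp (- 1 * (X \<omega> / x)) \<partial>M) = (\<integral>v. tail_prob M (\<lambda>\<omega>. X \<omega> / x) v \<partial>?E)"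
        using nonneg elim by (intro laplace_eq_tail_integral) (auto elim!: eventually_mono)
      also have "\<dots> = (\<integral>v. ?G (v * x) \<partial>?E)"
        using elim by (simp add: tail_prob_def pos_less_divide_eq)
      finally show ?case by simp
    qed
  qed
qed

section \<open>Random sums\<close>

text \<open>Presenting the generated sigma-algebra as a measure space lets the usual closure rules
  show that functions built from the family, such as partial sums, are measurable for it.\<close>

lemma family_sigma_measurable:
  assumes "i \<in> I" "Y i \<in> space M \<rightarrow> space S"
  shows "Y i \<in> measurable (sigma (space M) (\<Union>i\<in>I. {Y i -` A \<inter> space M | A. A \<in> sets S})) S"
proof (rule measurableI)
  fix A assume "A \<in> sets S"
  thus "Y i -` A \<inter> space (sigma (space M) (\<Union>i\<in>I. {Y i -` A \<inter> space M | A. A \<in> sets S}))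
    \<in> sets (sigma (space M) (\<Union>i\<in>I. {Y i -` A \<inter> space M | A. A \<in> sets S}))"
    using assms by (subst sets_measure_of) (auto simp: space_measure_of_conv intro!: sigma_sets.Basic)
qed (use assms in \<open>auto simp: space_measure_of_conv\<close>)

text \<open>The n-th term is dominated by the probability of N = n, and these probabilities are
  summable, so sum and integral can be exchanged. Letting \<open>f\<close> depend on both n and the
  outcome covers deterministic powers as well as transforms of partial sums.\<close>

lemma (in prob_space) expectation_split_nat:
  fixes f :: "nat \<Rightarrow> 'a \<Rightarrow> real"
  assumes N[measurable]: "N \<in> M \<rightarrow>\<^sub>M count_space UNIV"
    and f[measurable]: "\<And>n. f n \<in> borel_measurable M"
    and bound: "AE \<omega> in M. \<forall>n. \<bar>f n \<omega>\<bar> \<le> 1"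
  shows "(\<integral>\<omega>. f (N \<omega>) \<omega> \<partial>M) = (\<Sum>n. \<integral>\<omega>. indicator {\<omega> \<in> space M. N \<omega> = n} \<omega> * f n \<omega> \<partial>M)"
proof -
  define A where "A n = {\<omega> \<in> space M. N \<omega> = n}" for n
  have A_meas[measurable]: "A n \<in> sets M" for n unfolding A_def by measurable
  have bound_n: "AE \<omega> in M. \<bar>f n \<omega>\<bar> \<le> 1" for n using bound by eventually_elim auto
  have int_f: "integrable M (f n)" for n
    using bound_n by (intro integrable_const_bound[of _ 1]) auto
  have int_A: "integrable M (\<lambda>\<omega>. indicator (A n) \<omega> * f n \<omega>)" for n
    using integrable_mult_indicator[OF A_meas int_f] by simp
  have int_ind: "integrable M (indicat_real (A n))" for n
    by (intro integrable_real_indicator) (auto simp: emeasure_eq_measure)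
  have "(\<integral>\<omega>. f (N \<omega>) \<omega> \<partial>M) = (\<integral>\<omega>. (\<Sum>n. indicator (A n) \<omega> * f n \<omega>) \<partial>M)"
  proof (rule Bochner_Integration.integral_cong[OF refl])
    fix \<omega> assume w: "\<omega> \<in> space M"
    have "(\<lambda>n. indicator (A n) \<omega> * f n \<omega>) sums (\<Sum>n\<in>{N \<omega>}. indicator (A n) \<omega> * f n \<omega>)"
      by (rule sums_finite) (auto simp: A_def)
    thus "f (N \<omega>) \<omega> = (\<Sum>n. indicator (A n) \<omega> * f n \<omega>)"
      using w by (simp add: sums_iff A_def)
  qed
  also have "\<dots> = (\<Sum>n. \<integral>\<omega>. indicator (A n) \<omega> * f n \<omega> \<partial>M)"
  proof (rule integral_suminf[OF int_A])
    show "AE \<omega> in M. summable (\<lambda>n. norm (indicator (A n) \<omega> * f n \<omega>))"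
    proof (intro AE_I2)
      fix \<omega> show "summable (\<lambda>n. norm (indicator (A n) \<omega> * f n \<omega>))"
        by (rule summable_finite[of "{N \<omega>}"]) (auto simp: A_def)
    qed
    have le: "(\<integral>\<omega>. norm (indicator (A n) \<omega> * f n \<omega>) \<partial>M) \<le> prob (A n)" for n
    proof -
      have "(\<integral>\<omega>. norm (indicator (A n) \<omega> * f n \<omega>) \<partial>M) \<le> (\<integral>\<omega>. indicat_real (A n) \<omega> \<partial>M)"
        using bound_n[of n]
        by (intro integral_mono_AE integrable_norm int_A int_ind)
           (auto simp: indicator_def elim!: eventually_mono)
      also have "\<dots> = prob (A n)" by (simp add: Int_absorb2 sets.sets_into_space)
      finally show ?thesis .
    qed
    have "summable (\<lambda>n. prob (A n))"
      by (rule sums_summable[OF finite_measure_UNION]) (auto simp: disjoint_family_on_def A_def)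
    thus "summable (\<lambda>n. \<integral>\<omega>. norm (indicator (A n) \<omega> * f n \<omega>) \<partial>M)"
    proof (rule summable_comparison_test'[where N = 0])
      fix n
      have "0 \<le> (\<integral>\<omega>. norm (indicator (A n) \<omega> * f n \<omega>) \<partial>M)" by (rule integral_nonneg_AE) simp
      thus "norm (\<integral>\<omega>. norm (indicator (A n) \<omega> * f n \<omega>) \<partial>M) \<le> prob (A n)"
        using le[of n] by (simp only: real_norm_def abs_of_nonneg)
    qed
  qed
  finally show ?thesis by (simp add: A_def)
qed

lemma (in prob_space) prob_gen_fun_eq_expectation:
  assumes [measurable]: "N \<in> M \<rightarrow>\<^sub>M count_space UNIV" and w: "0 \<le> w" "w \<le> 1"
  shows "prob_gen_fun M N w = (\<integral>\<omega>. w ^ N \<omega> \<partial>M)"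
proof -
  have [measurable]: "{\<omega> \<in> space M. N \<omega> = n} \<in> sets M" for n by measurable
  have "(\<integral>\<omega>. w ^ N \<omega> \<partial>M) = (\<Sum>n. \<integral>\<omega>. indicator {\<omega> \<in> space M. N \<omega> = n} \<omega> * w ^ n \<partial>M)"
    by (rule expectation_split_nat) (use w in \<open>auto simp: power_le_one\<close>)
  also have "\<dots> = prob_gen_fun M N w"
    by (simp add: prob_gen_fun_def Int_absorb2 sets.sets_into_space)
  finally show ?thesis by simp
qed

text \<open>On the event N t = n the random sum is the n-th partial sum, which is independent of
  that event and has transform L^n. Summing over n produces the generating function at L.\<close>

lemma (in prob_space) expectation_random_sum:
  fixes X :: "nat \<Rightarrow> 'a \<Rightarrow> real" and N :: "'i \<Rightarrow> 'a \<Rightarrow> nat"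
  assumes indep: "indep_vars (\<lambda>_. borel) X {1..}"
    and ident: "\<And>k. k \<ge> 1 \<Longrightarrow> distr M borel (X k) = distr M borel (X 1)"
    and nonneg: "\<And>k. k \<ge> 1 \<Longrightarrow> AE \<omega> in M. X k \<omega> \<ge> 0"
    and N: "N t \<in> M \<rightarrow>\<^sub>M count_space UNIV" "t \<in> I"
    and NX: "indep_families M (count_space UNIV) N I borel X {1..}"
    and s: "s \<ge> 0"
  shows "random_sum X (N t) \<in> borel_measurable M"
    and "AE \<omega> in M. 0 \<le> random_sum X (N t) \<omega>"
    and "(\<integral>\<omega>. exp (- s * random_sum X (N t) \<omega>) \<partial>M) = prob_gen_fun M (N t) (\<integral>\<omega>. exp (- s * X 1 \<omega>) \<partial>M)"
proof -
  note [measurable] = N(1)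
  have X_meas[measurable]: "X k \<in> borel_measurable M" if "k \<ge> 1" for k
    using indep that by (auto simp: indep_vars_def)
  define L where "L = (\<integral>\<omega>. exp (- s * X 1 \<omega>) \<partial>M)"
  define S where "S n \<omega> = (\<Sum>k=1..n. X k \<omega>)" for n \<omega>
  \<comment> \<open>This carries the sigma-algebra generated by all \<open>X k\<close>;
    measurability of the partial sums with respect to it is what makes them independent of the
    counting process.\<close>
  define F where "F = sigma (space M) (\<Union>i\<in>{1..}. {X i -` A \<inter> space M | A. A \<in> sets borel})"
  have sets_F: "sets F = family_sigma M borel X {1..}"
    unfolding F_def family_sigma_def by (subst sets_measure_of) auto
  have sp_F: "space F = space M" unfolding F_def by (simp add: space_measure_of_conv)
  have X_F[measurable]: "X k \<in> borel_measurable F" if "k \<ge> 1" for k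
    unfolding F_def by (rule family_sigma_measurable) (use that in auto)
  have S_F[measurable]: "S n \<in> borel_measurable F" for n
    unfolding S_def by (intro borel_measurable_sum X_F) auto
  have S_M[measurable]: "S n \<in> borel_measurable M" for n
    unfolding S_def by (intro borel_measurable_sum X_meas) auto
  have rs: "random_sum X (N t) \<omega> = S (N t \<omega>) \<omega>" for \<omega> by (simp add: random_sum_def S_def)
  have "(\<lambda>\<omega>. S (N t \<omega>) \<omega>) \<in> borel_measurable M"
    by (rule measurable_compose_countable[OF S_M N(1)])
  thus meas[measurable]: "random_sum X (N t) \<in> borel_measurable M" using rs by (simp cong: measurable_cong)
  have ae: "AE \<omega> in M. \<forall>k\<in>{1..}. 0 \<le> X k \<omega>"
    using nonneg by (intro AE_ball_countable') auto
  have S_nonneg: "AE \<omega> in M. \<forall>n. 0 \<le> S n \<omega>"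
    using ae by eventually_elim (auto simp: S_def intro!: sum_nonneg)
  thus nn: "AE \<omega> in M. 0 \<le> random_sum X (N t) \<omega>"
    by eventually_elim (simp add: rs)

  have int_X: "integrable M (\<lambda>\<omega>. exp (- s * X k \<omega>))" if "k \<ge> 1" for k
    using nonneg[OF that] X_meas[OF that] s
    by (intro integrable_const_bound[of _ 1]) (auto elim!: eventually_mono)
  have int_S: "integrable M (\<lambda>\<omega>. exp (- s * S n \<omega>))" for n
    using S_nonneg s by (intro integrable_const_bound[of _ 1]) (auto elim!: eventually_mono)
  have L_k: "(\<integral>\<omega>. exp (- s * X k \<omega>) \<partial>M) = L" if "k \<ge> 1" for k
  proof -
    have "(\<integral>\<omega>. exp (- s * X k \<omega>) \<partial>M) = (\<integral>x. exp (- s * x) \<partial>distr M borel (X k))"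
      using X_meas[OF that] by (subst integral_distr) auto
    also have "\<dots> = (\<integral>x. exp (- s * x) \<partial>distr M borel (X 1))" using ident[OF that] by simp
    also have "\<dots> = L" unfolding L_def by (subst integral_distr) (auto intro: X_meas)
    finally show ?thesis .
  qed
  have E_S: "(\<integral>\<omega>. exp (- s * S n \<omega>) \<partial>M) = L ^ n" for n
  proof -
    have "(\<integral>\<omega>. exp (- s * S n \<omega>) \<partial>M) = (\<integral>\<omega>. (\<Prod>k\<in>{1..n}. exp (- s * X k \<omega>)) \<partial>M)"
      by (simp add: S_def sum_distrib_left exp_sum)
    also have "\<dots> = (\<Prod>k\<in>{1..n}. \<integral>\<omega>. exp (- s * X k \<omega>) \<partial>M)"
    proof (rule indep_vars_lebesgue_integral)
      have "indep_vars (\<lambda>_. borel) X {1..n}" by (rule indep_vars_subset[OF indep]) auto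
      thus "indep_vars (\<lambda>_. borel) (\<lambda>k \<omega>. exp (- s * X k \<omega>)) {1..n}"
        by (rule indep_vars_compose2) auto
    qed (use int_X in auto)
    also have "\<dots> = L ^ n" using L_k by simp
    finally show ?thesis .
  qed
  define A where "A n = {\<omega> \<in> space M. N t \<omega> = n}" for n
  have A_meas[measurable]: "A n \<in> sets M" for n unfolding A_def by measurable
  have E_AS: "(\<integral>\<omega>. indicator (A n) \<omega> * exp (- s * S n \<omega>) \<partial>M) = prob (A n) * L ^ n" for n
  proof -
    \<comment> \<open>Independence of the two families is inherited by smaller sigma-algebras, here
      those generated by the indicator of \<open>A n\<close> and by the transform of
      \<open>S n\<close>.\<close>
    have "indep_var borel (indicat_real (A n)) borel (\<lambda>\<omega>. exp (- s * S n \<omega>))"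
      unfolding indep_var_eq
    proof (intro conjI)
      let ?P = "family_sigma M (count_space UNIV) N I"
      let ?B = "sigma_sets (space M) {indicat_real (A n) -` B \<inter> space M | B. B \<in> sets borel}"
      let ?D = "sigma_sets (space M) {(\<lambda>\<omega>. exp (- s * S n \<omega>)) -` B \<inter> space M | B. B \<in> sets borel}"
      have ind: "indep_set ?P (family_sigma M borel X {1..})"
        using NX by (simp add: indep_families_def)
      define H where "H = sigma (space M) (\<Union>i\<in>I. {N i -` A \<inter> space M | A. A \<in> sets (count_space UNIV)})"
      have sets_H: "sets H = ?P" unfolding H_def family_sigma_def by (subst sets_measure_of) auto
      have sp_H: "space H = space M" unfolding H_def by (simp add: space_measure_of_conv)
      have "N t \<in> measurable H (count_space UNIV)"
        unfolding H_def by (rule family_sigma_measurable) (use N in auto)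
      hence "N t -` {n} \<inter> space H \<in> sets H" by (rule measurable_sets) simp
      also have "N t -` {n} \<inter> space H = A n" by (auto simp: A_def sp_H)
      finally have A_H: "A n \<in> sets H" .
      have "?B \<subseteq> sets H"
      proof -
        have "(indicat_real (A n)) \<in> borel_measurable H" using A_H by simp
        from measurable_sets[OF this] show ?thesis
          unfolding sp_H[symmetric] by (intro sets.sigma_sets_subset) auto
      qed
      moreover have "?D \<subseteq> sets F"
      proof -
        have "(\<lambda>\<omega>. exp (- s * S n \<omega>)) \<in> borel_measurable F" by measurable
        from measurable_sets[OF this] show ?thesis
          unfolding sp_F[symmetric] by (intro sets.sigma_sets_subset) auto
      qed
      ultimately show "indep_set ?B ?D"
        using ind unfolding indep_sets2_eq sets_F sets_H by blast
    qed measurable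
    hence "(\<integral>\<omega>. indicator (A n) \<omega> * exp (- s * S n \<omega>) \<partial>M) = (\<integral>\<omega>. indicator (A n) \<omega> \<partial>M) * (\<integral>\<omega>. exp (- s * S n \<omega>) \<partial>M)"
      by (rule indep_var_lebesgue_integral) (use int_S[of n] in \<open>auto intro!: integrable_real_indicator simp: emeasure_eq_measure\<close>)
    thus ?thesis using E_S by (simp add: Int_absorb2 sets.sets_into_space)
  qed
  have "(\<integral>\<omega>. exp (- s * random_sum X (N t) \<omega>) \<partial>M) = (\<integral>\<omega>. exp (- s * S (N t \<omega>) \<omega>) \<partial>M)"
    by (simp add: rs)
  also have "\<dots> = (\<Sum>n. \<integral>\<omega>. indicator (A n) \<omega> * exp (- s * S n \<omega>) \<partial>M)"
    unfolding A_def by (rule expectation_split_nat[OF N(1)])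
      (measurable, use S_nonneg s in \<open>auto elim!: eventually_mono\<close>)
  also have "\<dots> = prob_gen_fun M (N t) L" unfolding E_AS by (simp add: prob_gen_fun_def A_def)
  finally show "(\<integral>\<omega>. exp (- s * random_sum X (N t) \<omega>) \<partial>M) = prob_gen_fun M (N t) (\<integral>\<omega>. exp (- s * X 1 \<omega>) \<partial>M)"
    by (simp add: L_def)
qed

section \<open>Uniform asymptotics\<close>

lemma eventually_filtercomap_fst_principal:
  "eventually P (inf (filtercomap fst F) (principal {p. g (fst p) \<le> snd p})) \<longleftrightarrow>
    (\<forall>\<^sub>F t in F. \<forall>x\<ge>g t. P (t, x))" (is "?l \<longleftrightarrow> ?r")
proof
  assume ?l
  then obtain Q where "eventually Q F" "\<And>p. Q (fst p) \<Longrightarrow> g (fst p) \<le> snd p \<Longrightarrow> P p"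
    unfolding eventually_inf_principal eventually_filtercomap by auto
  thus ?r by (auto elim!: eventually_mono)
next
  assume ?r
  thus ?l unfolding eventually_inf_principal eventually_filtercomap by auto
qed

text \<open>Nonemptiness of the index sets matters for the lower bound, since an empty supremum in
  \<open>ereal\<close> is minus infinity.\<close>

lemma tendsto_SUP_ereal_0I:
  fixes f :: "'i \<Rightarrow> 'b \<Rightarrow> real"
  assumes nonneg: "\<And>t x. 0 \<le> f t x" and ne: "\<And>t. A t \<noteq> {}"
    and small: "\<And>\<epsilon>. \<epsilon> > 0 \<Longrightarrow> \<forall>\<^sub>F t in F. \<forall>x\<in>A t. f t x < \<epsilon>"
  shows "((\<lambda>t. SUP x\<in>A t. ereal (f t x)) \<longlongrightarrow> 0) F"
proof (rule order_tendstoI)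
  fix l :: ereal assume "l < 0"
  moreover have "0 \<le> (SUP x\<in>A t. ereal (f t x))" for t
    using ne[of t] nonneg by (metis SUP_upper2 all_not_in_conv ereal_less_eq(5))
  ultimately show "\<forall>\<^sub>F t in F. l < (SUP x\<in>A t. ereal (f t x))"
    by (intro always_eventually) (auto intro: less_le_trans)
next
  fix u :: ereal assume "0 < u"
  \<comment> \<open>The supremum of values below \<epsilon> may equal \<epsilon>, so \<epsilon> is
    taken strictly below \<open>u\<close>.\<close>
  then obtain \<epsilon> where \<epsilon>: "0 < ereal \<epsilon>" "ereal \<epsilon> < u" using ereal_dense2[of 0 u] by auto
  hence "\<forall>\<^sub>F t in F. \<forall>x\<in>A t. f t x < \<epsilon>" using small by simp
  thus "\<forall>\<^sub>F t in F. (SUP x\<in>A t. ereal (f t x)) < u"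
  proof eventually_elim
    case (elim t)
    hence "(SUP x\<in>A t. ereal (f t x)) \<le> ereal \<epsilon>" by (intro SUP_least) (auto intro: less_imp_le)
    thus ?case using \<epsilon>(2) by (rule le_less_trans)
  qed
qed

theorem corollary4:
  fixes M :: "'a measure"
    and X :: "nat \<Rightarrow> 'a \<Rightarrow> real"
    and N :: "real \<Rightarrow> 'a \<Rightarrow> nat"
    and C z xt :: "real \<Rightarrow> real"
    and E :: "real \<Rightarrow> real \<Rightarrow> real"
    and \<beta> \<gamma> :: real
  assumes M: "prob_space M"
    and \<beta>: "0 < \<beta>" "\<beta> < 1"
    and \<gamma>: "0 < \<gamma>" "\<gamma> < 1"
    and X_indep: "prob_space.indep_vars M (\<lambda>_. borel) X {1..}"
    and X_ident: "\<And>k. k \<ge> 1 \<Longrightarrow> distr M borel (X k) = distr M borel (X 1)"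
    and X_nonneg: "\<And>k. k \<ge> 1 \<Longrightarrow> AE \<omega> in M. X k \<omega> \<ge> 0"
    and X_RV: "reg_var_tail M \<beta> (X 1)"
    and N_meas: "\<And>t. t \<ge> 0 \<Longrightarrow> N t \<in> M \<rightarrow>\<^sub>M count_space UNIV"
    and NX_indep: "indep_families M (count_space UNIV) N {0..} borel X {1..}"
    and C_pos: "\<And>t. t \<ge> 0 \<Longrightarrow> C t > 0"
    and z_pos: "\<And>t. t \<ge> 0 \<Longrightarrow> z t > 0"
    and z_less: "\<And>t. t \<ge> 0 \<Longrightarrow> z t < 1"
    and z_lim: "(z \<longlongrightarrow> 1) at_top"
    and expansion: "\<And>t w. t \<ge> 0 \<Longrightarrow> 0 \<le> w \<Longrightarrow> w \<le> 1 \<Longrightarrow>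
          prob_gen_fun M (N t) w = 1 - C t * (1 - w) powr \<gamma> + E t (1 - w)"
    and E_small: "\<And>t. t \<ge> 0 \<Longrightarrow> E t \<in> o[at_right 0](\<lambda>u. u powr \<gamma>)"
    and E_unif: "\<And>\<kappa>. \<kappa> > 0 \<Longrightarrow>
          ((\<lambda>t. SUP w\<in>{w \<in> {0..1}. 0 < 1 - w \<and> 1 - w \<le> \<kappa> * (1 - z t)}.
               ereal (\<bar>E t (1 - w)\<bar> / (C t * (1 - w) powr \<gamma>))) \<longlongrightarrow> 0) at_top"
    and xt_lim: "filterlim xt at_top at_top"
    and xt_bound: "\<exists>K>0. \<forall>t\<ge>0. tail_prob M (X 1) (xt t) \<le> K * (1 - z t)"
  shows "((\<lambda>t. SUP x\<in>{xt t..}.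
            ereal \<bar>\<P>(\<omega> in M. random_sum X (N t) \<omega> > x) /
              (C_const \<gamma> \<beta> * \<P>(\<omega> in M. tail_prob M (X 1) x * real (N t \<omega>) > 1)) - 1\<bar>)
          \<longlongrightarrow> 0) at_top"
proof -
  interpret prob_space M by (rule M)
  let ?G = "tail_prob M (X 1)"
  have X1[measurable]: "X 1 \<in> borel_measurable M" using X_indep by (auto simp: indep_vars_def)
  note pos = reg_var_tail_pos[OF M X1 X_RV]
  have nonneg1: "AE \<omega> in M. 0 \<le> X 1 \<omega>" using X_nonneg[of 1] by simp
  obtain K where K: "K > 0" "\<And>t. t \<ge> 0 \<Longrightarrow> ?G (xt t) \<le> K * (1 - z t)" using xt_bound by auto
  define \<F> where "\<F> = inf (filtercomap fst at_top) (principal {p. xt (fst p) \<le> snd p})"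
  note ev_\<F> = eventually_filtercomap_fst_principal[where F = "at_top :: real filter" and g = xt, folded \<F>_def]
  have snd_lim: "filterlim snd at_top \<F>"
    unfolding filterlim_at_top
  proof
    fix Z
    have "\<forall>\<^sub>F t in at_top. Z \<le> xt t" using xt_lim by (simp add: filterlim_at_top)
    thus "\<forall>\<^sub>F p in \<F>. Z \<le> snd p" unfolding ev_\<F> by eventually_elim auto
  qed
  have ev_t: "\<forall>\<^sub>F p in \<F>. 0 \<le> fst p"
    unfolding ev_\<F> using eventually_ge_at_top[of 0] by eventually_elim auto
  have ev_x: "\<forall>\<^sub>F p in \<F>. 0 < snd p"
    using filterlim_at_top_dense[THEN iffD1, OF snd_lim] by auto
  \<comment> \<open>Since the tail decreases, the assumed bound at \<open>xt t\<close> holds for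
    every larger x with the same \<open>K\<close>.\<close>
  have ev_z: "\<forall>\<^sub>F p in \<F>. ?G (snd p) \<le> K * (1 - z (fst p))"
    unfolding ev_\<F> using eventually_ge_at_top[of 0]
    by eventually_elim (use K(2) antimonoD[OF tail_prob_antimono[OF M X1]] in \<open>auto intro: order_trans\<close>)
  \<comment> \<open>The supremum condition in pointwise form, with u = 1 - w; u \<le> 1 corresponds
    to w \<ge> 0.\<close>
  have err: "\<forall>\<^sub>F t in at_top. \<forall>u. 0 < u \<longrightarrow> u \<le> 1 \<longrightarrow> u \<le> \<kappa> * (1 - z t) \<longrightarrow> \<bar>E t u\<bar> \<le> \<epsilon> * (C t * u powr \<gamma>)"
    if "\<kappa> > 0" "\<epsilon> > 0" for \<kappa> \<epsilon>
  proof -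
    have "\<forall>\<^sub>F t in at_top. (SUP w\<in>{w \<in> {0..1}. 0 < 1 - w \<and> 1 - w \<le> \<kappa> * (1 - z t)}.
        ereal (\<bar>E t (1 - w)\<bar> / (C t * (1 - w) powr \<gamma>))) < ereal \<epsilon>"
      using order_tendstoD(2)[OF E_unif[OF \<open>\<kappa> > 0\<close>], of "ereal \<epsilon>"] \<open>\<epsilon> > 0\<close> by simp
    thus ?thesis using eventually_ge_at_top[of 0]
    proof eventually_elim
      case (elim t)
      show ?case
      proof (intro allI impI)
        fix u assume u: "0 < u" "u \<le> 1" "u \<le> \<kappa> * (1 - z t)"
        have "ereal (\<bar>E t (1 - (1 - u))\<bar> / (C t * (1 - (1 - u)) powr \<gamma>)) \<le>
          (SUP w\<in>{w \<in> {0..1}. 0 < 1 - w \<and> 1 - w \<le> \<kappa> * (1 - z t)}. ereal (\<bar>E t (1 - w)\<bar> / (C t * (1 - w) powr \<gamma>)))"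
          by (rule SUP_upper) (use u in auto)
        also note elim(1)
        finally have "\<bar>E t u\<bar> / (C t * u powr \<gamma>) < \<epsilon>" by simp
        thus "\<bar>E t u\<bar> \<le> \<epsilon> * (C t * u powr \<gamma>)"
          using C_pos[OF elim(2)] u by (simp add: pos_divide_less_eq less_imp_le)
      qed
    qed
  qed

  define a where "a p = C (fst p) * ?G (snd p) powr \<gamma>" for p
  have ev_a: "\<forall>\<^sub>F p in \<F>. 0 < a p"
    using ev_t by eventually_elim (use C_pos pos[THEN less_imp_neq] in \<open>auto simp: a_def\<close>)
  \<comment> \<open>This serves both transforms: d = s for the random times and d = Gamma(1-\<beta>)
    s^\<beta> for the sum. The leading term gives (U / F(x))^\<gamma>, which tends to d^\<gamma>.
    Eventually 0 < U < 2 d F(x) \<le> 2 d K (1 - z_t), so the remainder is uniformly small with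
    \<kappa> = 2 d K.\<close>
  have pgf_lim: "((\<lambda>p. (1 - prob_gen_fun M (N (fst p)) (1 - U p)) / a p) \<longlongrightarrow> d powr \<gamma>) \<F>"
    if U: "\<forall>\<^sub>F p in \<F>. U p \<le> 1" and lim: "((\<lambda>p. U p / ?G (snd p)) \<longlongrightarrow> d) \<F>" and d: "d > 0" for U d
  proof -
    let ?R = "\<lambda>p. E (fst p) (U p) / a p"
    have ev_U: "\<forall>\<^sub>F p in \<F>. 0 < U p \<and> U p < 2 * d * ?G (snd p)"
    proof -
      have "\<forall>\<^sub>F p in \<F>. U p / ?G (snd p) < 2 * d"
        by (rule order_tendstoD(2)[OF lim]) (use d in simp)
      with order_tendstoD(1)[OF lim d] show ?thesis
        by eventually_elim (use pos in \<open>simp add: pos_divide_less_eq pos_less_divide_eq\<close>)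
    qed
    have R: "(?R \<longlongrightarrow> 0) \<F>"
    proof (rule tendstoI)
      fix \<epsilon> :: real assume \<epsilon>: "\<epsilon> > 0"
      \<comment> \<open>The remainder is at most \<epsilon>' C_t (2 d F(x))^\<gamma> = \<epsilon>'
        (2 d)^\<gamma> \<open>a p\<close>, which for this \<epsilon>' is \<epsilon> / 2 times
        \<open>a p\<close>.\<close>
      define \<epsilon>' where "\<epsilon>' = \<epsilon> / (2 * (2 * d) powr \<gamma>)"
      have \<epsilon>': "\<epsilon>' > 0" "\<epsilon>' * (2 * d) powr \<gamma> < \<epsilon>" using \<epsilon> d by (auto simp: \<epsilon>'_def)
      have "\<forall>\<^sub>F p in \<F>. \<forall>u. 0 < u \<longrightarrow> u \<le> 1 \<longrightarrow> u \<le> (2 * d * K) * (1 - z (fst p)) \<longrightarrow>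
          \<bar>E (fst p) u\<bar> \<le> \<epsilon>' * (C (fst p) * u powr \<gamma>)"
        unfolding ev_\<F> using err[of "2 * d * K" \<epsilon>'] d K(1) \<epsilon>'(1) by (auto elim!: eventually_mono)
      thus "\<forall>\<^sub>F p in \<F>. dist (?R p) 0 < \<epsilon>"
        using ev_U U ev_z ev_t ev_a
      proof eventually_elim
        case (elim p)
        have "2 * d * ?G (snd p) \<le> 2 * d * (K * (1 - z (fst p)))"
          using elim(4) d by (intro mult_left_mono) auto
        hence "\<bar>E (fst p) (U p)\<bar> \<le> \<epsilon>' * (C (fst p) * U p powr \<gamma>)"
          using elim(1,2,3) by (auto simp: mult.assoc)
        also have "\<dots> \<le> \<epsilon>' * (C (fst p) * (2 * d * ?G (snd p)) powr \<gamma>)"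
          using elim(2) \<epsilon>' C_pos[OF elim(5)] \<gamma> by (intro mult_left_mono powr_mono2) auto
        also have "\<dots> = \<epsilon>' * (2 * d) powr \<gamma> * a p"
          using d pos[of "snd p"] by (simp add: a_def powr_mult)
        also have "\<dots> < \<epsilon> * a p" using \<epsilon>'(2) elim(6) by simp
        finally show ?case using elim(6) by (simp add: pos_divide_less_eq)
      qed
    qed
    have "((\<lambda>p. (U p / ?G (snd p)) powr \<gamma> - ?R p) \<longlongrightarrow> d powr \<gamma> - 0) \<F>"
      using d by (intro tendsto_intros lim R) auto
    moreover have "\<forall>\<^sub>F p in \<F>. (U p / ?G (snd p)) powr \<gamma> - ?R p = (1 - prob_gen_fun M (N (fst p)) (1 - U p)) / a p"
      using ev_U U ev_t
    proof eventually_elim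
      case (elim p)
      have "1 - prob_gen_fun M (N (fst p)) (1 - U p) = C (fst p) * U p powr \<gamma> - E (fst p) (U p)"
        using expansion[OF elim(3), of "1 - U p"] elim by simp
      thus ?case using elim pos[of "snd p"] C_pos[OF elim(3)]
        by (simp add: a_def diff_divide_distrib powr_divide)
    qed
    ultimately show ?thesis using Lim_transform_eventually by fastforce
  qed

  text \<open>Replacing \<open>N t\<close> by \<open>N (max 0 t)\<close> makes the random times measurable for every index.\<close>
  define N' where "N' t = N (max 0 t)" for t
  have N'_meas[measurable]: "N' t \<in> M \<rightarrow>\<^sub>M count_space UNIV" for t
    unfolding N'_def by (rule N_meas) simp
  have N'_eq: "N' t = N t" if "t \<ge> 0" for t using that by (simp add: N'_def)
  note rs = expectation_random_sum[OF X_indep X_ident X_nonneg N'_meas[unfolded N'_def] _ NX_indep, folded N'_def]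
  have G_lim: "((\<lambda>p. ?G (snd p)) \<longlongrightarrow> 0) \<F>"
    by (rule filterlim_compose[OF tail_prob_tendsto_0[OF M X1] snd_lim])

  have time: "((\<lambda>p. measure M {\<omega>\<in>space M. 1 < ?G (snd p) * real (N' (fst p) \<omega>)} / a p) \<longlongrightarrow> 1 / Gamma (1 - \<gamma>)) \<F>"
  proof (rule karamata_tauberian[OF M _ _ ev_a \<gamma>])
    fix s :: real assume s: "s > 0"
    \<comment> \<open>The argument is U = 1 - exp(-s F(x)). As F(x) is positive and tends to 0, U /
      F(x) tends to s.\<close>
    have "((\<lambda>u. (1 - exp (- s * u)) / u) \<longlongrightarrow> s) (at_right 0)" using s by real_asymp
    moreover have "filterlim (\<lambda>p. ?G (snd p)) (at_right 0) \<F>"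
      using G_lim pos pos[THEN less_imp_neq, THEN not_sym] by (simp add: filterlim_at)
    ultimately have "((\<lambda>p. (1 - exp (- s * ?G (snd p))) / ?G (snd p)) \<longlongrightarrow> s) \<F>"
      by (rule filterlim_compose)
    from pgf_lim[OF _ this s]
    have "((\<lambda>p. (1 - prob_gen_fun M (N (fst p)) (exp (- s * ?G (snd p)))) / a p) \<longlongrightarrow> s powr \<gamma>) \<F>"
      by simp
    moreover have "\<forall>\<^sub>F p in \<F>. (1 - prob_gen_fun M (N (fst p)) (exp (- s * ?G (snd p)))) / a p =
      (\<integral>\<omega>. 1 - exp (- s * (?G (snd p) * real (N' (fst p) \<omega>))) \<partial>M) / a p"
      using ev_t
    proof eventually_elim
      case (elim p)
      have "(\<integral>\<omega>. 1 - exp (- s * (?G (snd p) * real (N' (fst p) \<omega>))) \<partial>M) =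
        1 - (\<integral>\<omega>. exp (- s * (?G (snd p) * real (N' (fst p) \<omega>))) \<partial>M)"
        using s pos[of "snd p"]
        by (subst Bochner_Integration.integral_diff)
           (auto intro!: integrable_const_bound[of _ 1] simp: prob_space)
      also have "(\<integral>\<omega>. exp (- s * (?G (snd p) * real (N' (fst p) \<omega>))) \<partial>M) = (\<integral>\<omega>. exp (- s * ?G (snd p)) ^ N' (fst p) \<omega> \<partial>M)"
        by (simp add: exp_of_nat_mult[symmetric] mult_ac)
      also have "\<dots> = prob_gen_fun M (N' (fst p)) (exp (- s * ?G (snd p)))"
        using s pos[of "snd p"] by (intro prob_gen_fun_eq_expectation[symmetric]) auto
      finally show ?case using N'_eq[OF elim] by simp
    qed
    ultimately show "((\<lambda>p. (\<integral>\<omega>. 1 - exp (- s * (?G (snd p) * real (N' (fst p) \<omega>))) \<partial>M) / a p) \<longlongrightarrow> 1 * s powr \<gamma>) \<F>"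
      using Lim_transform_eventually by fastforce
  qed (use pos[THEN less_imp_le] in auto)

  have sum: "((\<lambda>p. measure M {\<omega>\<in>space M. 1 < random_sum X (N' (fst p)) \<omega> / snd p} / a p)
    \<longlongrightarrow> Gamma (1 - \<beta>) powr \<gamma> / Gamma (1 - \<gamma> * \<beta>)) \<F>"
  proof (rule karamata_tauberian[OF M _ _ ev_a])
    show "0 < \<gamma> * \<beta>" using \<beta> \<gamma> by simp
    show "\<gamma> * \<beta> < 1" using \<beta> \<gamma> mult_strict_mono[of \<gamma> 1 \<beta> 1] by simp
    show "0 \<le> Gamma (1 - \<beta>) powr \<gamma>" by simp
    show "(\<lambda>\<omega>. random_sum X (N' (fst p)) \<omega> / snd p) \<in> borel_measurable M" for p
      \<comment> \<open>The 0 instantiates \<open>s\<close>, which does not occur in this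
        conclusion.\<close>
      using rs(1)[of "fst p" 0] by simp
    show "\<forall>\<^sub>F p in \<F>. AE \<omega> in M. 0 \<le> random_sum X (N' (fst p)) \<omega> / snd p"
      using ev_x
    proof eventually_elim
      case (elim p)
      show ?case using rs(2)[of "fst p" 0] elim by (auto elim!: eventually_mono)
    qed
    fix s :: real assume s: "s > 0"
    have int_X: "integrable M (\<lambda>\<omega>. exp (- c * X 1 \<omega>))" if "c \<ge> 0" for c
      using nonneg1 X1 that by (intro integrable_const_bound[of _ 1]) (auto elim!: eventually_mono)
    \<comment> \<open>This is 1 - E exp(-(s / x) X_1) written at scale x / s. The Abelian theorem
      compares it with F(x / s), and regular variation turns F(x / s) / F(x) into s^\<beta>.\<close>
    define U where "U x = (\<integral>\<omega>. 1 - exp (- (X 1 \<omega> / (1 / s * x))) \<partial>M)" for x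
    have "filterlim (\<lambda>x. 1 / s * x) at_top at_top"
      using s by (intro filterlim_tendsto_pos_mult_at_top[OF tendsto_const]) (auto simp: filterlim_ident)
    from filterlim_compose[OF abelian_laplace_tail[OF M X1 nonneg1 X_RV \<beta>] this]
    have "((\<lambda>x. U x / ?G (1 / s * x) * (?G (1 / s * x) / ?G x)) \<longlongrightarrow> Gamma (1 - \<beta>) * (1 / s) powr (- \<beta>)) at_top"
      unfolding U_def using s by (intro tendsto_mult reg_var_tail_ratio[OF X_RV]) auto
    also have "(\<lambda>x. U x / ?G (1 / s * x) * (?G (1 / s * x) / ?G x)) = (\<lambda>x. U x / ?G x)"
      using pos[THEN less_imp_neq] by (intro ext) (simp add: field_simps)
    also have "(1 / s) powr (- \<beta>) = s powr \<beta>" using s by (simp add: powr_divide powr_minus)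
    finally have "((\<lambda>p. U (snd p) / ?G (snd p)) \<longlongrightarrow> Gamma (1 - \<beta>) * s powr \<beta>) \<F>"
      by (rule filterlim_compose[OF _ snd_lim])
    moreover have U_eq: "U x = 1 - (\<integral>\<omega>. exp (- (s / x) * X 1 \<omega>) \<partial>M)" if "x > 0" for x
      unfolding U_def using int_X[of "s / x"] s that
      by (subst Bochner_Integration.integral_diff) (auto simp: prob_space mult.commute)
    hence "\<forall>\<^sub>F p in \<F>. U (snd p) \<le> 1"
      using ev_x by (auto elim!: eventually_mono)
    moreover have "Gamma (1 - \<beta>) * s powr \<beta> > 0" using \<beta> s by (simp add: Gamma_real_pos)
    ultimately have "((\<lambda>p. (1 - prob_gen_fun M (N (fst p)) (1 - U (snd p))) / a p) \<longlongrightarrow> (Gamma (1 - \<beta>) * s powr \<beta>) powr \<gamma>) \<F>"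
      by (intro pgf_lim)
    also have "(Gamma (1 - \<beta>) * s powr \<beta>) powr \<gamma> = Gamma (1 - \<beta>) powr \<gamma> * s powr (\<gamma> * \<beta>)"
      using Gamma_real_pos[of "1 - \<beta>"] \<beta> by (simp add: powr_mult powr_powr mult.commute)
    finally show "((\<lambda>p. (\<integral>\<omega>. 1 - exp (- s * (random_sum X (N' (fst p)) \<omega> / snd p)) \<partial>M) / a p) \<longlongrightarrow>
      Gamma (1 - \<beta>) powr \<gamma> * s powr (\<gamma> * \<beta>)) \<F>"
    proof (rule Lim_transform_eventually)
      show "\<forall>\<^sub>F p in \<F>. (1 - prob_gen_fun M (N (fst p)) (1 - U (snd p))) / a p =
        (\<integral>\<omega>. 1 - exp (- s * (random_sum X (N' (fst p)) \<omega> / snd p)) \<partial>M) / a p"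
        using ev_t ev_x
      proof eventually_elim
        case (elim p)
        have c: "s / snd p \<ge> 0" using s elim by simp
        have [measurable]: "random_sum X (N' (fst p)) \<in> borel_measurable M" by (rule rs(1)[OF _ _ _ c]) simp_all
        have int: "integrable M (\<lambda>\<omega>. exp (- (s / snd p) * random_sum X (N' (fst p)) \<omega>))"
        proof (rule integrable_const_bound[of _ 1])
          have "AE \<omega> in M. 0 \<le> random_sum X (N' (fst p)) \<omega>" by (rule rs(2)[OF _ _ _ c]) simp_all
          thus "AE \<omega> in M. norm (exp (- (s / snd p) * random_sum X (N' (fst p)) \<omega>)) \<le> 1"
            using s elim by (auto elim!: eventually_mono)
        qed measurable
        have "(\<integral>\<omega>. 1 - exp (- s * (random_sum X (N' (fst p)) \<omega> / snd p)) \<partial>M) =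
          1 - (\<integral>\<omega>. exp (- (s / snd p) * random_sum X (N' (fst p)) \<omega>) \<partial>M)"
          using Bochner_Integration.integral_diff[OF integrable_const[of 1] int] by (simp add: prob_space)
        also have "(\<integral>\<omega>. exp (- (s / snd p) * random_sum X (N' (fst p)) \<omega>) \<partial>M) =
          prob_gen_fun M (N' (fst p)) (\<integral>\<omega>. exp (- (s / snd p) * X 1 \<omega>) \<partial>M)"
          by (rule rs(3)[OF _ _ _ c]) simp_all
        finally show ?case using N'_eq[OF elim(1)] U_eq[OF elim(2)] by simp
      qed
    qed
  qed

  have Gam: "Gamma (1 - \<gamma>) > 0" "Gamma (1 - \<beta>) > 0" "Gamma (1 - \<gamma> * \<beta>) > 0"
    using \<beta> \<gamma> mult_strict_mono[of \<gamma> 1 \<beta> 1] by (auto intro!: Gamma_real_pos)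
  have Cc: "C_const \<gamma> \<beta> > 0" using Gam by (simp add: C_const_def)
  let ?S = "\<lambda>t x. \<P>(\<omega> in M. random_sum X (N t) \<omega> > x)"
  let ?T = "\<lambda>t x. \<P>(\<omega> in M. ?G x * real (N t \<omega>) > 1)"
  have "((\<lambda>p. (measure M {\<omega>\<in>space M. 1 < random_sum X (N' (fst p)) \<omega> / snd p} / a p) /
      (C_const \<gamma> \<beta> * (measure M {\<omega>\<in>space M. 1 < ?G (snd p) * real (N' (fst p) \<omega>)} / a p)))
    \<longlongrightarrow> (Gamma (1 - \<beta>) powr \<gamma> / Gamma (1 - \<gamma> * \<beta>)) / (C_const \<gamma> \<beta> * (1 / Gamma (1 - \<gamma>)))) \<F>"
    using Cc Gam by (intro tendsto_intros sum time) auto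
  also have "(Gamma (1 - \<beta>) powr \<gamma> / Gamma (1 - \<gamma> * \<beta>)) / (C_const \<gamma> \<beta> * (1 / Gamma (1 - \<gamma>))) = 1"
    using Gam by (simp add: C_const_def)
  finally have ratio: "((\<lambda>p. ?S (fst p) (snd p) / (C_const \<gamma> \<beta> * ?T (fst p) (snd p))) \<longlongrightarrow> 1) \<F>"
  proof (rule Lim_transform_eventually)
    show "\<forall>\<^sub>F p in \<F>. (measure M {\<omega>\<in>space M. 1 < random_sum X (N' (fst p)) \<omega> / snd p} / a p) /
      (C_const \<gamma> \<beta> * (measure M {\<omega>\<in>space M. 1 < ?G (snd p) * real (N' (fst p) \<omega>)} / a p)) =
      ?S (fst p) (snd p) / (C_const \<gamma> \<beta> * ?T (fst p) (snd p))"
      using ev_t ev_x ev_a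
      by eventually_elim (simp add: N'_eq pos_less_divide_eq)
  qed
  have "\<forall>\<^sub>F t in at_top. \<forall>x\<in>{xt t..}. \<bar>?S t x / (C_const \<gamma> \<beta> * ?T t x) - 1\<bar> < \<epsilon>" if "\<epsilon> > 0" for \<epsilon>
    using tendstoD[OF ratio that] by (simp add: ev_\<F> dist_real_def Ball_def)
  thus ?thesis by (intro tendsto_SUP_ereal_0I) auto
qed

end
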